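(* Let $k \geq 2$ and let $f : \mathbb{T}^k \to \mathbb{T}^k$ be a diffeomorphism of the $k$-torus $\mathbb{T}^k = \mathbb{R}^k/\mathbb{Z}^k$. Suppose that $f$ is semiconjugate to a minimal translation $R$ of $\mathbb{T}^k$ by a semiconjugacy $\varphi$ (that is, $\varphi : \mathbb{T}^k \to \mathbb{T}^k$ is a continuous surjective map with $\varphi \circ f = R \circ \varphi$), and that $f$ is not (topologically) conjugate to $R$. If for every point $p \in \mathbb{T}^k$ the preimage $\varphi^{-1}(p)$ is either a single point or a Euclidean ball, then $f$ is not of class $C^{k+1}$.
   Context: $\mathbb{T}^k = \mathbb{R}^k/\mathbb{Z}^k$ carries the flat metric induced from the Euclidean metric of $\mathbb{R}^k$. A translation of $\mathbb{T}^k$ is a map $R(x) = x + \theta$ with $\theta \in \mathbb{T}^k$; it is minimal if all its orbits are dense. A Euclidean ball in $\mathbb{T}^k$ is an embedded round ball of positive radius for the flat metric, i.e. the image, under the projection $\mathbb{R}^k \to \mathbb{T}^k$, of a (closed) round ball of $\mathbb{R}^k$ on which this projection is injective. Topologically conjugate means conjugate by a homeomorphism. *)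

theory Defs
  imports "HOL-Analysis.Analysis"
begin

section \<open>The flat torus\<close>

definition int_lattice :: "(real ^ 'n) set" where
  "int_lattice = {m. \<forall>i. m $ i \<in> \<int>}"

lemma int_lattice_0 [simp]: "0 \<in> int_lattice"
  by (simp add: int_lattice_def)

lemma int_lattice_add: "a \<in> int_lattice \<Longrightarrow> b \<in> int_lattice \<Longrightarrow> a + b \<in> int_lattice"
  by (simp add: int_lattice_def)

lemma int_lattice_minus: "a \<in> int_lattice \<Longrightarrow> - a \<in> int_lattice"
  by (simp add: int_lattice_def)

lemma int_lattice_diff: "a \<in> int_lattice \<Longrightarrow> b \<in> int_lattice \<Longrightarrow> a - b \<in> int_lattice"
  by (simp add: int_lattice_def)

lemma closed_int_lattice: "closed (int_lattice :: (real ^ 'n) set)"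
proof -
  have "closed {m :: real ^ 'n. m $ i \<in> \<int>}" for i
    using continuous_closed_vimage[OF closed_Ints, of "\<lambda>m :: real ^ 'n. m $ i"]
    by (auto simp: vimage_def intro: continuous_intros)
  then show ?thesis
    unfolding int_lattice_def by (rule closed_Collect_all)
qed

definition torus_rel :: "real ^ 'n \<Rightarrow> real ^ 'n \<Rightarrow> bool" where
  "torus_rel x y \<longleftrightarrow> x - y \<in> int_lattice"

lemma equivp_torus_rel: "equivp torus_rel"
proof (rule equivpI)
  show "reflp torus_rel"
    by (simp add: reflp_def torus_rel_def)
  show "symp torus_rel"
    using int_lattice_minus by (fastforce simp: symp_def torus_rel_def)
  show "transp torus_rel"
    unfolding transp_def torus_rel_def
    by (metis int_lattice_add diff_add_cancel add_diff_eq)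
qed

quotient_type (overloaded) 'n torus = "real ^ 'n::finite" / torus_rel
  morphisms torus_rep torus_proj
  by (rule equivp_torus_rel)

lemma torus_proj_eq_iff: "torus_proj x = torus_proj y \<longleftrightarrow> x - y \<in> int_lattice"
  by (simp add: torus.abs_eq_iff torus_rel_def)

lemma surj_torus_proj: "surj torus_proj"
  by (metis Quotient3_torus Quotient3_def surjI)

instantiation torus :: (finite) ab_group_add
begin

lift_definition zero_torus :: "'a torus" is 0 .

lift_definition plus_torus :: "'a torus \<Rightarrow> 'a torus \<Rightarrow> 'a torus" is "(+)"
  using int_lattice_add by (fastforce simp: torus_rel_def algebra_simps)

lift_definition uminus_torus :: "'a torus \<Rightarrow> 'a torus" is uminus
  using int_lattice_minus by (fastforce simp: torus_rel_def algebra_simps)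

lift_definition minus_torus :: "'a torus \<Rightarrow> 'a torus \<Rightarrow> 'a torus" is "(-)"
  using int_lattice_diff by (fastforce simp: torus_rel_def algebra_simps)

instance
  by standard (transfer, simp add: torus_rel_def algebra_simps)+

end

text \<open>The topology is defined as the quotient topology; the \<open>metric_space\<close> instance proves that
  it is the topology of the flat distance.\<close>

lemma infdist_lattice_mono:
  assumes "a - b \<in> int_lattice"
  shows "infdist a int_lattice \<le> infdist b int_lattice"
proof -
  have "infdist a int_lattice \<le> dist b m" if "m \<in> int_lattice" for m
    using infdist_le[OF int_lattice_add[OF that assms], of a] by (simp add: dist_norm)
  then show ?thesis
    unfolding infdist_notempty[of int_lattice b, OF ex_in_conv[THEN iffD1, OF exI, OF int_lattice_0]]
    by (intro cINF_greatest) (use int_lattice_0 in blast)+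
qed

lemma infdist_lattice_cong:
  assumes "a - b \<in> int_lattice"
  shows "infdist a int_lattice = infdist b int_lattice"
  using infdist_lattice_mono[OF assms] infdist_lattice_mono[of b a] int_lattice_minus[OF assms]
  by simp

lemma infdist_lattice_less:
  assumes "infdist a int_lattice < e"
  obtains m where "m \<in> int_lattice" "dist a m < e"
proof -
  have ne: "int_lattice \<noteq> ({} :: (real ^ 'b) set)"
    using int_lattice_0 by blast
  have "\<exists>m\<in>int_lattice. dist a m < e"
    using assms ne unfolding infdist_notempty[OF ne]
    by (subst (asm) cINF_less_iff) auto
  then show ?thesis using that by blast
qed

lemma infdist_lattice_minus: "infdist (- a) int_lattice \<le> infdist a int_lattice"
proof (rule field_le_epsilon)
  fix e :: real assume "e > 0"
  then obtain m where m: "m \<in> int_lattice" "dist a m < infdist a int_lattice + e"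
    using infdist_lattice_less[of a "infdist a int_lattice + e"] by auto
  show "infdist (- a) int_lattice \<le> infdist a int_lattice + e"
    using infdist_le[OF int_lattice_minus[OF m(1)], of "- a"] m(2)
    by (simp add: dist_minus)
qed

lemma infdist_lattice_add:
  "infdist (a + b) int_lattice \<le> infdist a int_lattice + infdist b int_lattice"
proof (rule field_le_epsilon)
  fix e :: real assume "e > 0"
  then obtain m n where m: "m \<in> int_lattice" "dist a m < infdist a int_lattice + e/2"
    and n: "n \<in> int_lattice" "dist b n < infdist b int_lattice + e/2"
    using infdist_lattice_less[of a "infdist a int_lattice + e/2"]
      infdist_lattice_less[of b "infdist b int_lattice + e/2"] by (metis half_gt_zero less_add_same_cancel1)
  have "dist (a + b) (m + n) \<le> dist a m + dist b n"
    by (rule dist_triangle_add)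
  then show "infdist (a + b) int_lattice \<le> infdist a int_lattice + infdist b int_lattice + e"
    using infdist_le[OF int_lattice_add[OF m(1) n(1)], of "a + b"] m(2) n(2) by simp
qed

instantiation torus :: (finite) metric_space
begin

lift_definition dist_torus :: "'a torus \<Rightarrow> 'a torus \<Rightarrow> real" is
  "\<lambda>x y. infdist (x - y) int_lattice"
proof -
  fix x x' y y' :: "real ^ 'a"
  assume "torus_rel x x'" "torus_rel y y'"
  then have "(x - y) - (x' - y') \<in> int_lattice"
    using int_lattice_diff by (fastforce simp: torus_rel_def algebra_simps)
  then show "infdist (x - y) int_lattice = infdist (x' - y') int_lattice"
    by (rule infdist_lattice_cong)
qed

definition open_torus :: "'a torus set \<Rightarrow> bool" where
  "open_torus U \<longleftrightarrow> open (torus_proj -` U)"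

definition uniformity_torus :: "('a torus \<times> 'a torus) filter" where
  "uniformity_torus = (INF e\<in>{0<..}. principal {(x, y). dist x y < e})"

instance
proof
  show "(uniformity :: ('a torus \<times> 'a torus) filter) =
      (INF e\<in>{0<..}. principal {(x, y). dist x y < e})"
    by (rule uniformity_torus_def)
  have ev: "eventually P (uniformity :: ('a torus \<times> 'a torus) filter) \<longleftrightarrow>
      (\<exists>e>0. \<forall>x y. dist x y < e \<longrightarrow> P (x, y))" for P
    unfolding uniformity_torus_def
    by (subst eventually_INF_base)
       (auto simp: eventually_principal subset_eq intro: bexI[of _ "min _ _"])
  fix U :: "'a torus set"
  have "open U \<longleftrightarrow> (\<forall>x\<in>U. \<exists>e>0. \<forall>y. dist x y < e \<longrightarrow> y \<in> U)"
  proof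
    assume "open U"
    then have op: "open (torus_proj -` U)" by (simp add: open_torus_def)
    show "\<forall>x\<in>U. \<exists>e>0. \<forall>y. dist x y < e \<longrightarrow> y \<in> U"
    proof
      fix x assume "x \<in> U"
      obtain a where a: "x = torus_proj a" using surj_torus_proj by blast
      then obtain e where e: "e > 0" "ball a e \<subseteq> torus_proj -` U"
        using op \<open>x \<in> U\<close> by (metis open_contains_ball vimageI)
      have "y \<in> U" if d: "dist x y < e" for y
      proof -
        obtain b where b: "y = torus_proj b" using surj_torus_proj by blast
        have "infdist (a - b) int_lattice < e"
          using d by (simp add: a b dist_torus.abs_eq)
        then obtain m where m: "m \<in> int_lattice" "dist (a - b) m < e"
          by (rule infdist_lattice_less)
        have "b + m \<in> ball a e"
          using m(2) by (simp add: dist_norm algebra_simps)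
        moreover have "torus_proj (b + m) = y"
          using m(1) by (simp add: b torus_proj_eq_iff)
        ultimately show "y \<in> U" using e(2) by blast
      qed
      with e(1) show "\<exists>e>0. \<forall>y. dist x y < e \<longrightarrow> y \<in> U" by blast
    qed
  next
    assume R: "\<forall>x\<in>U. \<exists>e>0. \<forall>y. dist x y < e \<longrightarrow> y \<in> U"
    have "\<exists>e>0. ball a e \<subseteq> torus_proj -` U" if "a \<in> torus_proj -` U" for a
    proof -
      from that R obtain e where e: "e > 0" "\<And>y. dist (torus_proj a) y < e \<Longrightarrow> y \<in> U"
        by blast
      have "torus_proj b \<in> U" if "dist a b < e" for b
        using e(2)[of "torus_proj b"] infdist_le[OF int_lattice_0, of "a - b"] that
        by (simp add: dist_torus.abs_eq dist_norm)
      with e(1) show ?thesis by (intro exI[of _ e]) auto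
    qed
    then show "open U" by (simp add: open_torus_def open_contains_ball)
  qed
  then show "open U \<longleftrightarrow> (\<forall>x\<in>U. \<forall>\<^sub>F (x', y) in uniformity. x' = x \<longrightarrow> y \<in> U)"
    by (auto simp: ev)
next
  fix x y :: "'a torus"
  have "int_lattice \<noteq> ({} :: (real ^ 'a) set)"
    using int_lattice_0 by blast
  then show "dist x y = 0 \<longleftrightarrow> x = y"
    by transfer (simp add: torus_rel_def in_closed_iff_infdist_zero[OF closed_int_lattice])
next
  fix x y z :: "'a torus"
  show "dist x y \<le> dist x z + dist y z"
  proof transfer
    fix x y z :: "real ^ 'a"
    show "infdist (x - y) int_lattice \<le> infdist (x - z) int_lattice + infdist (y - z) int_lattice"
      using infdist_lattice_add[of "x - z" "z - y"] infdist_lattice_minus[of "y - z"] by simp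
  qed
qed

end

definition euclidean_ball :: "'n::finite torus set \<Rightarrow> bool" where
  "euclidean_ball B \<longleftrightarrow>
    (\<exists>c r. r > 0 \<and> inj_on torus_proj (cball c r) \<and> B = torus_proj ` cball c r)"

section \<open>Differentiability classes\<close>

text \<open>\<open>Ck_on\<close> is meant for open \<open>S\<close> only, since it uses derivatives \<open>at x\<close>
  rather than \<open>at x within S\<close>.\<close>

primrec Ck_on :: "nat \<Rightarrow> ('a::real_normed_vector \<Rightarrow> 'b::real_normed_vector) \<Rightarrow> 'a set \<Rightarrow> bool"
where
  "Ck_on 0 f S \<longleftrightarrow> continuous_on S f"
| "Ck_on (Suc r) f S \<longleftrightarrow>
    (\<forall>x\<in>S. f differentiable (at x)) \<and> (\<forall>v. Ck_on r (\<lambda>x. frechet_derivative f (at x) v) S)"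

text \<open>The charts of the torus are the inverses of the restrictions of the projection to open sets
  on which it is injective. Below, \<open>U\<close> and \<open>V\<close> are the images of two such charts.\<close>

definition torus_Ck :: "nat \<Rightarrow> ('n::finite torus \<Rightarrow> 'n torus) \<Rightarrow> bool" where
  "torus_Ck r f \<longleftrightarrow> continuous_on UNIV f \<and>
    (\<forall>U V. open U \<and> open V \<and> inj_on torus_proj U \<and> inj_on torus_proj V \<longrightarrow>
      Ck_on r (\<lambda>x. the_inv_into V torus_proj (f (torus_proj x)))
        {x \<in> U. f (torus_proj x) \<in> torus_proj ` V})"

definition torus_diffeomorphism :: "('n::finite torus \<Rightarrow> 'n torus) \<Rightarrow> bool" where
  "torus_diffeomorphism f \<longleftrightarrow> bij f \<and> torus_Ck 1 f \<and> torus_Ck 1 (inv f)"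

section \<open>Dynamics\<close>

definition translation :: "('n::finite torus \<Rightarrow> 'n torus) \<Rightarrow> bool" where
  "translation R \<longleftrightarrow> (\<exists>\<theta>. R = (\<lambda>x. x + \<theta>))"

text \<open>Two-sided orbits, for bijective \<open>f\<close>.\<close>

definition full_orbit :: "('a \<Rightarrow> 'a) \<Rightarrow> 'a \<Rightarrow> 'a set" where
  "full_orbit f x = range (\<lambda>n. (f ^^ n) x) \<union> range (\<lambda>n. (inv f ^^ n) x)"

definition minimal :: "('a::topological_space \<Rightarrow> 'a) \<Rightarrow> bool" where
  "minimal f \<longleftrightarrow> (\<forall>x. closure (full_orbit f x) = UNIV)"

definition semiconjugacy ::
  "('a::topological_space \<Rightarrow> 'b::topological_space) \<Rightarrow> ('a \<Rightarrow> 'a) \<Rightarrow> ('b \<Rightarrow> 'b) \<Rightarrow> bool" where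
  "semiconjugacy \<phi> f g \<longleftrightarrow> continuous_on UNIV \<phi> \<and> surj \<phi> \<and> \<phi> \<circ> f = g \<circ> \<phi>"

definition topologically_conjugate ::
  "('a::topological_space \<Rightarrow> 'a) \<Rightarrow> ('b::topological_space \<Rightarrow> 'b) \<Rightarrow> bool" where
  "topologically_conjugate f g \<longleftrightarrow> (\<exists>h h'. homeomorphism UNIV UNIV h h' \<and> h \<circ> f = g \<circ> h)"

end

(* Points that are not interior to a fibre are limits of ball fibres shrinking to them, and f maps
   these balls to balls; hence the derivative of f is a similarity there. By compactness, every
   iterate of f is 2-quasiconformal at small scales outside finitely many ball fibres; the scale
   depends on the iterate, but the constant 2 does not.

   Take a ball fibre over p0. Its images under the iterates of f have radii tending to 0. Join this
   ball to its exterior by short parallel segments. For an iterate g that shrinks the ball to radius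
   less than s, let the cutoff be 0 on the preimage under g of the concentric ball of radius s and 1
   off that of radius 2s. Every segment carries total variation at least 1 of the cutoff. Cover the
   torus by the finitely many big fibres and by small balls in the quasiconformal part. Fibres are
   counted as atoms, as in transboundary modulus: each covering set contributes the oscillation of
   the cutoff times diam^(k-1), where k is the dimension. Since g maps covering sets to sets that
   are round up to a bounded factor, the k-th powers of the oscillations have sum bounded
   independently of s (packing in the target), while the k-th powers of the diameters are bounded
   by the volume of a punctured neighbourhood of the fibre, which tends to 0 with s. Young's
   inequality then contradicts the fixed width of the family of segments. *)

theory Submission
  imports Defs
begin

section \<open>Geometry of the flat torus\<close>

text \<open>The scale at which an iterate becomes quasiconformal is out of control, so no estimate
  may depend on it. Packing bounds meet this need: they compare disjoint balls with one volume,
  whatever their number and size. The constant 2 survives iteration because \<open>f\<close> is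
  K-quasiconformal for every K > 1, so that 2 can be split into factors, one for each step. Inside a
  big fibre there is no distortion bound for the iterate, but none is needed: the fibre and its
  image are both round, and only the two radii enter. The order of the choices is essential: first
  the weight M of Young's inequality, which makes the bounded sum of oscillations small; then the
  neighbourhood of the fibre, whose volume has to be small even after multiplication by M; then s,
  and the iterate last. The weight can be used only because the exponent k - 1 is positive. For k =
  1 the diameters drop out of the sum and nothing becomes small, in accordance with Denjoy's C^1
  diffeomorphisms of the circle, whose fibres over a minimal rotation are points and arcs.\<close>

lemma dist_torus_proj: "dist (torus_proj a) (torus_proj b) = infdist (a - b) int_lattice"
  by (rule dist_torus.abs_eq)

lemma dist_torus_proj_le: "dist (torus_proj a) (torus_proj b) \<le> dist a b"
  unfolding dist_torus_proj using infdist_le[OF int_lattice_0, of "a - b"] by (simp add: dist_norm)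

lemma norm_int_lattice_ge_1:
  fixes m :: "real ^ 'n::finite"
  assumes "m \<in> int_lattice" "m \<noteq> 0"
  shows "norm m \<ge> 1"
proof -
  obtain i where i: "m $ i \<noteq> 0"
    using assms(2) by (metis vec_eq_iff zero_index)
  have "m $ i \<in> \<int>" using assms(1) by (simp add: int_lattice_def)
  then have "\<bar>m $ i\<bar> \<ge> 1" using i by (rule Ints_nonzero_abs_ge1)
  then show ?thesis using component_le_norm_cart[of m i] by linarith
qed

lemma dist_torus_proj_eq:
  fixes a b :: "real ^ 'n::finite"
  assumes "dist a b \<le> 1/2"
  shows "dist (torus_proj a) (torus_proj b) = dist a b"
proof (rule antisym[OF dist_torus_proj_le])
  have "dist a b \<le> dist (a - b) m" if m: "m \<in> int_lattice" for m
  proof (cases "m = 0")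
    case False
    have "norm m \<le> norm (a - b) + dist (a - b) m"
      using norm_triangle_ineq4[of "a - b" "(a - b) - m"] by (simp add: dist_norm)
    then show ?thesis using norm_int_lattice_ge_1[OF m False] assms by (simp add: dist_norm)
  qed (simp add: dist_norm)
  moreover have "int_lattice \<noteq> ({} :: (real ^ 'n) set)" using int_lattice_0 by blast
  ultimately show "dist a b \<le> dist (torus_proj a) (torus_proj b)"
    unfolding dist_torus_proj infdist_notempty[OF \<open>int_lattice \<noteq> _\<close>]
    by (intro cINF_greatest) auto
qed

lemma torus_lift_near:
  assumes "dist (torus_proj a) x < e"
  obtains b where "torus_proj b = x" "dist a b < e"
proof -
  obtain b0 where b0: "x = torus_proj b0" using surj_torus_proj by blast
  obtain m where m: "m \<in> int_lattice" "dist (a - b0) m < e"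
    using infdist_lattice_less assms unfolding b0 dist_torus_proj by blast
  show ?thesis
  proof (rule that[of "b0 + m"])
    show "torus_proj (b0 + m) = x" using m(1) by (simp add: b0 torus_proj_eq_iff)
    show "dist a (b0 + m) < e" using m(2) by (simp add: dist_norm algebra_simps)
  qed
qed

lemma torus_proj_ball: "torus_proj ` ball a e = ball (torus_proj a) e"
proof
  show "torus_proj ` ball a e \<subseteq> ball (torus_proj a) e"
    using dist_torus_proj_le order.strict_trans1 by fastforce
  show "ball (torus_proj a) e \<subseteq> torus_proj ` ball a e"
    using torus_lift_near by (metis image_eqI mem_ball subsetI)
qed

lemma continuous_on_torus_proj: "continuous_on S torus_proj"
  unfolding continuous_on_iff using dist_torus_proj_le order.strict_trans1 by blast

lemma compact_torus: "compact (UNIV :: 'n::finite torus set)"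
proof -
  have "x \<in> torus_proj ` cbox 0 1" for x :: "'n torus"
  proof -
    obtain a where a: "x = torus_proj a" using surj_torus_proj by blast
    define b where "b = (\<chi> i. frac (a $ i))"
    have "b - a \<in> int_lattice"
      by (simp add: int_lattice_def b_def frac_def)
    then have "torus_proj b = x" by (simp add: a torus_proj_eq_iff)
    moreover have "b \<in> cbox 0 1"
      by (simp add: mem_box_cart b_def less_imp_le[OF frac_lt_1])
    ultimately show ?thesis by blast
  qed
  then have "(UNIV :: 'n torus set) = torus_proj ` cbox 0 1" by blast
  then show ?thesis
    using compact_continuous_image[OF continuous_on_torus_proj compact_cbox] by metis
qed

lemma dist_torus_add_right: "dist (x + z) (y + z) = dist x (y :: 'n::finite torus)"
  by transfer (simp add: algebra_simps)

lemma inj_on_torus_proj_ball: "inj_on torus_proj (ball a (1/4))"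
proof (rule inj_onI)
  fix x y assume xy: "x \<in> ball a (1/4)" "y \<in> ball a (1/4)" "torus_proj x = torus_proj y"
  have "dist x y \<le> 1/2" using xy dist_triangle_le[of x a y "1/2"] by (simp add: dist_commute)
  from dist_torus_proj_eq[OF this] xy(3) show "x = y" by simp
qed

text \<open>The antipodal points at distance 1/2 from the centre along a coordinate axis differ by a
  lattice vector.\<close>

lemma inj_on_torus_proj_cball_radius:
  fixes c :: "real ^ 'n::finite"
  assumes "inj_on torus_proj (cball c r)"
  shows "r < 1/2"
proof (rule ccontr)
  assume r: "\<not> r < 1/2"
  define e :: "real ^ 'n" where "e = axis undefined 1"
  have e: "norm e = 1" "e \<in> int_lattice"
    unfolding e_def by (rule norm_axis_1) (simp add: int_lattice_def axis_def)
  let ?x = "c + (1/2) *\<^sub>R e" and ?y = "c - (1/2) *\<^sub>R e"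
  have "?x - ?y = e" by (simp add: scaleR_left.add[symmetric])
  then have "torus_proj ?x = torus_proj ?y" using e by (simp add: torus_proj_eq_iff)
  moreover have "?x \<in> cball c r" "?y \<in> cball c r" using e r by (auto simp: dist_norm)
  ultimately have "?x = ?y" using assms by (metis inj_onD)
  then show False using \<open>?x - ?y = e\<close> e by simp
qed

text \<open>The two inclusions between \<open>B\<close> and metric balls of the torus let most later
  arguments use \<open>dist\<close> alone, without a choice of lifts.\<close>

lemma euclidean_ballE:
  fixes B :: "'n::finite torus set"
  assumes "euclidean_ball B"
  obtains c r where "0 < r" "r < 1/2" "inj_on torus_proj (cball c r)" "B = torus_proj ` cball c r"
    "ball (torus_proj c) r \<subseteq> B" "B \<subseteq> cball (torus_proj c) r"
proof -
  obtain c r where c: "r > 0" "inj_on torus_proj (cball c r)" "B = torus_proj ` cball c r"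
    using assms by (auto simp: euclidean_ball_def)
  have "ball (torus_proj c) r \<subseteq> B"
    unfolding torus_proj_ball[symmetric] c(3) by (intro image_mono ball_subset_cball)
  moreover have "B \<subseteq> cball (torus_proj c) r"
    unfolding c(3) using dist_torus_proj_le order_trans by fastforce
  ultimately show ?thesis using that c inj_on_torus_proj_cball_radius by blast
qed

section \<open>Separated sets and nets\<close>

lemma separated_card_bound:
  fixes S :: "'a::metric_space set"
  assumes "compact S" "h > 0"
  shows "\<exists>N. \<forall>X\<subseteq>S. (\<forall>x\<in>X. \<forall>y\<in>X. x \<noteq> y \<longrightarrow> dist x y \<ge> h) \<longrightarrow> finite X \<and> card X \<le> N"
proof -
  obtain k where k: "finite k" "S \<subseteq> (\<Union>x\<in>k. ball x (h/2))"
    using assms compact_eq_totally_bounded half_gt_zero by metis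
  show ?thesis
  proof (intro exI[of _ "card k"] allI impI)
    fix X assume "X \<subseteq> S" and "\<forall>x\<in>X. \<forall>y\<in>X. x \<noteq> y \<longrightarrow> dist x y \<ge> h"
    then have X: "X \<subseteq> S" "\<And>x y. x \<in> X \<Longrightarrow> y \<in> X \<Longrightarrow> x \<noteq> y \<Longrightarrow> dist x y \<ge> h" by auto
    have "\<forall>x\<in>X. \<exists>c. c \<in> k \<and> dist c x < h/2" using k(2) X(1) by fastforce
    then obtain c where c: "\<And>x. x \<in> X \<Longrightarrow> c x \<in> k \<and> dist (c x) x < h/2" by metis
    have "inj_on c X"
    proof (rule inj_onI, rule ccontr)
      fix x y assume xy: "x \<in> X" "y \<in> X" "c x = c y" "x \<noteq> y"
      have "dist x y < h"
        using c[OF xy(1)] c[OF xy(2)] xy(3) dist_triangle_half_r[of "c x" x h y] by simp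
      then show False using X(2)[OF xy(1,2,4)] by simp
    qed
    moreover have "c ` X \<subseteq> k" using c by blast
    ultimately show "finite X \<and> card X \<le> card k"
      using k(1) by (meson card_inj_on_le inj_on_finite)
  qed
qed

text \<open>A separated set of greatest cardinality is a net, since a point far from it could be
  added. \<open>separated_card_bound\<close> ensures that a greatest cardinality exists.\<close>

lemma separated_net:
  fixes S W :: "'a::metric_space set"
  assumes "compact S" "h > 0" "W \<subseteq> S"
  obtains X where "finite X" "X \<subseteq> W" "\<And>x y. x \<in> X \<Longrightarrow> y \<in> X \<Longrightarrow> x \<noteq> y \<Longrightarrow> dist x y \<ge> h"
    "W \<subseteq> (\<Union>x\<in>X. ball x h)"
proof -
  let ?P = "\<lambda>X. X \<subseteq> W \<and> (\<forall>x\<in>X. \<forall>y\<in>X. x \<noteq> y \<longrightarrow> dist x y \<ge> h)"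
  obtain N where N: "\<forall>X\<subseteq>S. (\<forall>x\<in>X. \<forall>y\<in>X. x \<noteq> y \<longrightarrow> dist x y \<ge> h) \<longrightarrow> finite X \<and> card X \<le> N"
    using separated_card_bound[OF assms(1,2)] by (elim exE)
  have fin: "finite X \<and> card X \<le> N" if "?P X" for X
    by (rule N[rule_format]) (use that assms(3) in auto)
  have "\<forall>Y. ?P Y \<longrightarrow> card Y < Suc N"
    by (intro allI impI le_imp_less_Suc conjunct2[OF fin])
  then have "\<exists>X. ?P X \<and> (\<forall>Y. ?P Y \<longrightarrow> card Y \<le> card X)"
    by (intro ex_has_greatest_nat[of ?P "{}" card "Suc N"]) simp_all
  then obtain X where Xmax: "?P X \<and> (\<forall>Y. ?P Y \<longrightarrow> card Y \<le> card X)" by (elim exE)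
  note X = conjunct1[OF Xmax] and max = conjunct2[OF Xmax]
  have "y \<in> (\<Union>x\<in>X. ball x h)" if y: "y \<in> W" for y
  proof (rule ccontr)
    assume n: "y \<notin> (\<Union>x\<in>X. ball x h)"
    then have far: "dist x y \<ge> h" if "x \<in> X" for x using that by (force simp: not_less)
    then have "?P (insert y X)" using X y by (simp add: dist_commute)
    moreover have "y \<notin> X" using far[of y] assms(2) by auto
    ultimately
    show False using max[rule_format, of "insert y X"] fin[OF X] by simp
  qed
  then show ?thesis
    by (intro that[of X]) (use X fin[OF X] in auto)
qed

section \<open>Semiconjugacies with round fibres\<close>

lemma infinite_torus: "infinite (UNIV :: 'n::finite torus set)"
proof
  assume "finite (UNIV :: 'n torus set)"
  then have "finite (torus_proj ` ball 0 (1/4) :: 'n torus set)" by (rule rev_finite_subset) simp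
  then have "finite (ball 0 (1/4) :: (real ^ 'n) set)"
    using finite_imageD inj_on_torus_proj_ball by blast
  then have "ball 0 (1/4) = ({} :: (real ^ 'n) set)" using finite_imp_not_open by blast
  then show False by simp
qed

lemma euclidean_ball_not_singleton: "\<not> euclidean_ball {x :: 'n::finite torus}"
proof
  assume "euclidean_ball {x}"
  then obtain c r where c: "0 < r" "inj_on torus_proj (cball c r)" "{x} = torus_proj ` cball c r"
    by (rule euclidean_ballE)
  then have "cball c r = {c}"
    by (metis centre_in_cball image_eqI inj_onD less_imp_le singletonD singletonI
          subsetI subset_singletonD equals0D)
  then show False using c(1) by (metis cball_eq_sing less_irrefl)
qed

lemma dist_closed_point_pos:
  fixes C :: "'a::metric_space set"
  assumes "closed C" "p \<notin> C"
  shows "\<exists>d>0. \<forall>y\<in>C. d \<le> dist p y"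
proof -
  obtain d where d: "d > 0" "ball p d \<subseteq> - C"
    using assms openE[of "- C" p] by (auto simp: open_Compl)
  then have "\<forall>y\<in>C. d \<le> dist p y" by (meson ComplD mem_ball not_le subsetD)
  then show ?thesis using d(1) by blast
qed

text \<open>The configuration to be refuted. A point \<open>p0\<close> with a ball fibre exists as
  soon as \<open>\<phi>\<close> is not injective; \<open>C1_inv_f\<close> is the source of all lower
  bounds for distances under \<open>f\<close>.\<close>

locale round_fibres =
  fixes f \<phi> :: "'n::finite torus \<Rightarrow> 'n torus" and \<theta> p0 :: "'n torus"
  assumes bij_f: "bij f"
    and C1_f: "torus_Ck 1 f" and C1_inv_f: "torus_Ck 1 (inv f)"
    and cont_phi: "continuous_on UNIV \<phi>"
    and semiconj: "\<phi> (f x) = \<phi> x + \<theta>"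
    and fibres: "(\<exists>x. \<phi> -` {p} = {x}) \<or> euclidean_ball (\<phi> -` {p})"
    and ball_p0: "euclidean_ball (\<phi> -` {p0})"
    and dense_orbit: "closure (full_orbit (\<lambda>x. x + \<theta>) p0) = UNIV"
begin

abbreviation T :: "'n torus \<Rightarrow> 'n torus" where "T \<equiv> \<lambda>x. x + \<theta>"

abbreviation fibre :: "'n torus \<Rightarrow> 'n torus set" where "fibre p \<equiv> \<phi> -` {p}"

lemma inv_T: "inv T = (\<lambda>x. x - \<theta>)"
  by (rule inv_unique_comp) auto

lemma cont_f: "continuous_on UNIV f" and cont_inv_f: "continuous_on UNIV (inv f)"
  using C1_f C1_inv_f by (auto simp: torus_Ck_def)

lemma f_inv_f [simp]: "f (inv f x) = x" and inv_f_f [simp]: "inv f (f x) = x"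
  using bij_f by (auto simp: bij_is_surj surj_f_inv_f bij_is_inj inv_f_f)

section \<open>The action of \<open>f\<close> on the fibres\<close>

lemma fibre_image: "f ` fibre p = fibre (p + \<theta>)"
proof
  show "f ` fibre p \<subseteq> fibre (p + \<theta>)" by (auto simp: semiconj)
  show "fibre (p + \<theta>) \<subseteq> f ` fibre p"
  proof
    fix x assume x: "x \<in> fibre (p + \<theta>)"
    then have "\<phi> (inv f x) + \<theta> = p + \<theta>" using semiconj[of "inv f x"] by simp
    then have "inv f x \<in> fibre p" by simp
    then show "x \<in> f ` fibre p" by (metis f_inv_f image_eqI)
  qed
qed

lemma ball_fibre_iff: "euclidean_ball (fibre p) \<longleftrightarrow> (\<nexists>x. fibre p = {x})"
  using fibres[of p] euclidean_ball_not_singleton by metis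

text \<open>A diffeomorphism has no reason to map round balls to round balls. Here the dichotomy
  forces it: a bijection maps a fibre with several points to a fibre with several points, and such a
  fibre is a ball.\<close>

lemma ball_fibre_shift: "euclidean_ball (fibre (p + \<theta>)) \<longleftrightarrow> euclidean_ball (fibre p)"
proof -
  have "(\<exists>x. f ` fibre p = {x}) \<longleftrightarrow> (\<exists>x. fibre p = {x})"
    using bij_f by (metis bij_is_inj image_empty image_insert inj_image_eq_iff f_inv_f)
  then show ?thesis by (simp add: ball_fibre_iff fibre_image)
qed

lemma ball_fibre_orbit:
  assumes "q \<in> full_orbit T p0"
  shows "euclidean_ball (fibre q)"
proof -
  have "euclidean_ball (fibre ((T ^^ n) p0))" for n
    by (induction n) (use ball_p0 ball_fibre_shift in auto)
  moreover have "euclidean_ball (fibre ((inv T ^^ n) p0))" for n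
  proof (induction n)
    case (Suc n)
    then show ?case using ball_fibre_shift[of "(inv T ^^ Suc n) p0"] by (simp add: inv_T)
  qed (use ball_p0 in simp)
  ultimately show ?thesis using assms by (auto simp: full_orbit_def)
qed

text \<open>Distinct fibres are disjoint, so the centre of one inscribed ball lies outside the
  others. The centres are thus \<open>d\<close>-separated in a compact space.\<close>

lemma finite_fat_fibres:
  assumes "d > 0"
  shows "finite {q. \<exists>x. ball x d \<subseteq> fibre q}"
proof -
  let ?Q = "{q. \<exists>x. ball x d \<subseteq> fibre q}"
  define x where "x = (\<lambda>q. SOME x. ball x d \<subseteq> fibre q)"
  have x: "ball (x q) d \<subseteq> fibre q" if "q \<in> ?Q" for q
    using someI_ex[of "\<lambda>x. ball x d \<subseteq> fibre q"] that by (simp add: x_def)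
  have far: "dist (x q) (x q') \<ge> d" if "q \<in> ?Q" "q' \<in> ?Q" "q \<noteq> q'" for q q'
  proof (rule ccontr)
    assume "\<not> dist (x q) (x q') \<ge> d"
    then have "x q' \<in> ball (x q) d" "x q' \<in> ball (x q') d" using assms by auto
    then have "\<phi> (x q') = q" "\<phi> (x q') = q'" using x[OF that(1)] x[OF that(2)] by blast+
    then show False using that by simp
  qed
  have "\<forall>a\<in>x ` ?Q. \<forall>b\<in>x ` ?Q. a \<noteq> b \<longrightarrow> dist a b \<ge> d"
  proof (intro ballI impI)
    fix a b assume "a \<in> x ` ?Q" "b \<in> x ` ?Q" and ne: "a \<noteq> b"
    then obtain q q' where "q \<in> ?Q" "q' \<in> ?Q" "a = x q" "b = x q'" by (elim imageE)
    then show "dist a b \<ge> d" using far[of q q'] ne by auto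
  qed
  moreover obtain N where "\<forall>X\<subseteq>UNIV. (\<forall>a\<in>X. \<forall>b\<in>X. a \<noteq> b \<longrightarrow> dist a (b :: 'n torus) \<ge> d)
      \<longrightarrow> finite X \<and> card X \<le> N"
    using separated_card_bound[OF compact_torus assms] by (elim exE)
  ultimately have "finite (x ` ?Q)"
    by (elim allE[of _ "x ` ?Q"]) (simp only: subset_UNIV simp_thms)
  moreover have "inj_on x ?Q"
  proof (rule inj_onI, rule ccontr)
    fix q q' assume "q \<in> ?Q" "q' \<in> ?Q" "x q = x q'" "q \<noteq> q'"
    then show False using far[of q q'] assms by simp
  qed
  ultimately show ?thesis by (rule finite_imageD)
qed

lemma ball_fibre_fat:
  assumes "ball x e \<subseteq> fibre q" "e > 0"
  shows "euclidean_ball (fibre q)"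
proof (rule ccontr)
  assume "\<not> euclidean_ball (fibre q)"
  then obtain y where y: "fibre q = {y}" using fibres[of q] by blast
  obtain a where a: "x = torus_proj a" using surj_torus_proj by blast
  let ?U = "ball a e \<inter> ball a (1/4)"
  have "torus_proj ` ?U \<subseteq> {y}" using torus_proj_ball[of a e] assms(1) y a by blast
  then have "finite (torus_proj ` ?U)" using finite_subset by blast
  then have "finite ?U"
    using finite_imageD inj_on_subset[OF inj_on_torus_proj_ball] by (metis inf_le2)
  then have "?U = {}" using finite_imp_not_open open_Int[OF open_ball open_ball] by blast
  moreover have "a \<in> ?U" using assms(2) by simp
  ultimately show False by blast
qed

text \<open>Upper semicontinuity of the fibres: the image of the compact complement of
  \<open>U\<close> is closed and misses \<open>p\<close>.\<close>

lemma fibre_neighbourhood: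
  assumes "fibre p \<subseteq> U" "open U"
  obtains t where "t > 0" "\<phi> -` ball p t \<subseteq> U"
proof -
  have "compact (- U)"
    using compact_Int_closed[OF compact_torus closed_Compl[OF assms(2)]] by simp
  then have "compact (\<phi> ` (- U))"
    by (rule compact_continuous_image[OF continuous_on_subset[OF cont_phi subset_UNIV]])
  moreover have "p \<notin> \<phi> ` (- U)" using assms(1) by auto
  ultimately obtain t where "t > 0" "\<forall>y\<in>\<phi> ` (- U). t \<le> dist p y"
    using dist_closed_point_pos[OF compact_imp_closed] by blast
  then show ?thesis by (intro that[of t]) force+
qed

lemma ball_fibre_in_ball:
  assumes "fibre (\<phi> x) = {x}" "e > 0"
  shows "\<exists>q. euclidean_ball (fibre q) \<and> fibre q \<subseteq> ball x e"
proof -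
  obtain t where t: "t > 0" "\<phi> -` ball (\<phi> x) t \<subseteq> ball x e"
    using fibre_neighbourhood[of "\<phi> x" "ball x e"] assms by auto
  have "\<phi> x \<in> closure (full_orbit T p0)" by (simp add: dense_orbit)
  then obtain q where q: "q \<in> full_orbit T p0" "dist q (\<phi> x) < t"
    using t(1) unfolding closure_approachable by blast
  then have "fibre q \<subseteq> \<phi> -` ball (\<phi> x) t" by (auto simp: dist_commute)
  then show ?thesis using q(1) ball_fibre_orbit t(2) by blast
qed

text \<open>Near \<open>x\<close> there is a point \<open>y\<close> outside the fibre of
  \<open>x\<close> and outside the finitely many other fat fibres, which are closed and do not
  contain \<open>x\<close>. The fibre of \<open>y\<close> is then a small ball through
  \<open>y\<close>, or the single point \<open>y\<close>, near which density of the orbit of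
  \<open>p0\<close> provides small ball fibres.\<close>

lemma small_ball_fibres:
  assumes nonint: "\<And>e q. e > 0 \<Longrightarrow> \<not> ball x e \<subseteq> fibre q" and "e > 0"
  shows "\<exists>q. euclidean_ball (fibre q) \<and> fibre q \<subseteq> ball x e"
proof -
  \<comment> \<open>The fibre of \<open>x\<close> is left out because \<open>x\<close> may lie on
    the boundary of a large ball fibre.\<close>
  let ?Q = "{q. \<exists>y. ball y (e/4) \<subseteq> fibre q} - {\<phi> x}"
  have fin: "finite ?Q" using finite_fat_fibres[of "e/4"] \<open>e > 0\<close> by simp
  have "closed (fibre q)" for q using cont_phi by (simp add: closed_vimage)
  then have "closed (\<Union>q\<in>?Q. fibre q)" using fin by blast
  moreover have "x \<notin> (\<Union>q\<in>?Q. fibre q)" by auto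
  ultimately obtain d where d: "d > 0" "\<forall>y\<in>(\<Union>q\<in>?Q. fibre q). d \<le> dist x y"
    using dist_closed_point_pos[of "\<Union>q\<in>?Q. fibre q" x] by blast
  obtain y where y: "y \<in> ball x (min d (e/2))" "\<phi> y \<noteq> \<phi> x"
    using nonint[of "min d (e/2)" "\<phi> x"] d(1) \<open>e > 0\<close> by (auto simp: subset_iff)
  show ?thesis
  proof (cases "euclidean_ball (fibre (\<phi> y))")
    case False
    then obtain z where "fibre (\<phi> y) = {z}" using fibres[of "\<phi> y"] by blast
    moreover have "y \<in> fibre (\<phi> y)" by simp
    ultimately have "fibre (\<phi> y) = {y}" by (metis singletonD)
    moreover have "ball y (e/2) \<subseteq> ball x e"
      by (rule subsetI) (use y(1) dist_triangle_half_r[of y x e] in \<open>simp add: dist_commute\<close>)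
    ultimately show ?thesis using ball_fibre_in_ball[of y "e/2"] \<open>e > 0\<close> by fastforce
  next
    case True
    then obtain c r where c: "0 < r" "ball (torus_proj c) r \<subseteq> fibre (\<phi> y)"
       "fibre (\<phi> y) \<subseteq> cball (torus_proj c) r"
      by (rule euclidean_ballE)
    have "\<phi> y \<notin> ?Q" using d(2) y(1) by force
    then have "\<not> ball (torus_proj c) (e/4) \<subseteq> fibre (\<phi> y)" using y(2) by auto
    then have r: "r < e/4" using c(2) subset_ball[of "e/4" r] by force
    have "dist x z < e" if z: "z \<in> fibre (\<phi> y)" for z
    proof -
      have "dist (torus_proj c) z \<le> r" "dist (torus_proj c) y \<le> r" using c(3) z by auto
      then show ?thesis using r y(1) dist_triangle[of x z y] dist_triangle2[of y z "torus_proj c"]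
        by (simp add: dist_commute)
    qed
    then show ?thesis using True by auto
  qed
qed

text \<open>A finite forward orbit would be mapped onto itself by \<open>T\<close>, hence contain
  the backward orbit too; the full orbit would be finite and dense in an infinite space.\<close>

lemma infinite_forward_orbit: "infinite (range (\<lambda>n. (T ^^ n) p0))" (is "infinite ?P")
proof
  assume fin: "finite ?P"
  have sub: "T ` ?P \<subseteq> ?P"
  proof (rule image_subsetI)
    fix x assume "x \<in> ?P"
    then obtain n where "x = (T ^^ n) p0" by blast
    then show "x + \<theta> \<in> ?P" by (intro range_eqI[of _ _ "Suc n"]) simp
  qed
  have "inj_on T ?P" by (simp add: inj_on_def)
  then have surj: "T ` ?P = ?P" using endo_inj_surj fin sub by blast
  have "(inv T ^^ n) p0 \<in> ?P" for n
  proof (induction n)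
    case 0 show ?case by (rule range_eqI[of _ _ 0]) simp
  next
    case (Suc n)
    then obtain y where "y \<in> ?P" "(inv T ^^ n) p0 = y + \<theta>" using surj by (metis (no_types, lifting) imageE)
    then show ?case by (simp add: inv_T)
  qed
  then have "full_orbit T p0 \<subseteq> ?P" by (auto simp: full_orbit_def)
  then have "finite (full_orbit T p0)" using fin finite_subset by blast
  then have "full_orbit T p0 = UNIV" using dense_orbit by (metis closure_closed finite_imp_closed)
  then show False using \<open>finite (full_orbit T p0)\<close> infinite_torus by metis
qed

text \<open>The forward orbit of \<open>p0\<close> runs through infinitely many ball fibres, and
  only finitely many of them can be fat.\<close>

lemma thin_fibre_forward:
  assumes "s > 0"
  obtains n c r where "0 < r" "r < s" "inj_on torus_proj (cball c r)"
    "fibre ((T ^^ n) p0) = torus_proj ` cball c r"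
proof -
  have "\<not> range (\<lambda>n. (T ^^ n) p0) \<subseteq> {q. \<exists>x. ball x s \<subseteq> fibre q}"
    using infinite_forward_orbit finite_fat_fibres[OF assms] finite_subset by blast
  then obtain n where n: "\<nexists>x. ball x s \<subseteq> fibre ((T ^^ n) p0)" by blast
  have "euclidean_ball (fibre ((T ^^ n) p0))" by (rule ball_fibre_orbit) (auto simp: full_orbit_def)
  then obtain c r where c: "0 < r" "inj_on torus_proj (cball c r)"
      "fibre ((T ^^ n) p0) = torus_proj ` cball c r" "ball (torus_proj c) r \<subseteq> fibre ((T ^^ n) p0)"
    by (rule euclidean_ballE)
  then have "r < s" using n subset_ball[of s r] by (meson not_le_imp_less order_trans)
  then show ?thesis using that c by blast
qed

end

section \<open>Infinitesimal conformality\<close>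

text \<open>Strong differentiability of a lift of \<open>f\<close>. The two-point form of the
  estimate is what matters: it applies to small balls near \<open>a\<close> that are not centred at
  \<open>a\<close>.\<close>

lemma C1_strong_derivative:
  fixes f :: "'n::finite torus \<Rightarrow> 'n torus" and a :: "real ^ 'n"
  assumes "torus_Ck 1 f"
  obtains F A d where "d > 0" "linear A" "\<And>y. y \<in> ball a d \<Longrightarrow> torus_proj (F y) = f (torus_proj y)"
    "\<And>e. e > 0 \<Longrightarrow> \<exists>\<delta>>0. \<delta> \<le> d \<and>
       (\<forall>y\<in>ball a \<delta>. \<forall>z\<in>ball a \<delta>. norm (F y - F z - A (y - z)) \<le> e * norm (y - z))"
proof -
  obtain b where b: "f (torus_proj a) = torus_proj b" using surj_torus_proj by blast
  define V where "V = ball b (1/4)"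
  define F where "F = (\<lambda>x. the_inv_into V torus_proj (f (torus_proj x)))"
  define S where "S = {x \<in> ball a (1/4). f (torus_proj x) \<in> torus_proj ` V}"
  define DF where "DF = (\<lambda>x. frechet_derivative F (at x))"
  have inj: "inj_on torus_proj V" unfolding V_def by (rule inj_on_torus_proj_ball)
  have "Ck_on 1 F S"
    using assms inj_on_torus_proj_ball inj unfolding torus_Ck_def F_def S_def V_def by blast
  then have diff: "\<And>x. x \<in> S \<Longrightarrow> (F has_derivative DF x) (at x)"
    and cont: "\<And>v. continuous_on S (\<lambda>x. DF x v)"
    by (auto simp: DF_def frechet_derivative_works)
  have "continuous_on UNIV (\<lambda>x. f (torus_proj x))"
    using assms by (intro continuous_on_compose2[OF _ continuous_on_torus_proj]) (auto simp: torus_Ck_def)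
  then have "open ((\<lambda>x. f (torus_proj x)) -` ball (torus_proj b) (1/4))"
    by (simp add: open_vimage)
  then have "open (ball a (1/4) \<inter> (\<lambda>x. f (torus_proj x)) -` ball (torus_proj b) (1/4))"
    by (intro open_Int open_ball)
  moreover have "S = ball a (1/4) \<inter> (\<lambda>x. f (torus_proj x)) -` ball (torus_proj b) (1/4)"
    by (auto simp: S_def V_def torus_proj_ball)
  ultimately have "open S" by simp
  have "a \<in> S" by (auto simp: S_def b V_def)
  then obtain d where d: "d > 0" "ball a d \<subseteq> S" using \<open>open S\<close> openE by blast
  have lin: "linear (DF x)" if "x \<in> S" for x
    using diff[OF that] by (simp add: has_derivative_bounded_linear bounded_linear.linear)
  \<comment> \<open>\<open>Ck_on\<close> gives continuity of the derivative only in each fixed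
    direction. The sum over a basis dominates the operator norm and is still continuous.\<close>
  define w where "w = (\<lambda>x. \<Sum>i\<in>Basis. norm (DF x i - DF a i))"
  have contw: "continuous_on S w"
    unfolding w_def by (intro continuous_intros cont)
  have on: "onorm (DF x - DF a) \<le> w x" if "x \<in> S" for x
  proof (rule onorm_le)
    fix v
    have l: "linear (DF x - DF a)"
      using linear_compose_sub[OF lin[OF that] lin[OF \<open>a \<in> S\<close>]] by (simp add: fun_diff_def)
    have "(DF x - DF a) v = (DF x - DF a) (\<Sum>i\<in>Basis. (v \<bullet> i) *\<^sub>R i)"
      by (simp add: euclidean_representation)
    also have "\<dots> = (\<Sum>i\<in>Basis. (v \<bullet> i) *\<^sub>R (DF x - DF a) i)"
      by (simp only: linear_sum[OF l] linear_scale[OF l])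
    also have "norm \<dots> \<le> (\<Sum>i\<in>Basis. norm v * norm (DF x i - DF a i))"
      by (intro sum_norm_le) (auto intro!: mult_right_mono simp: Basis_le_norm)
    finally show "norm ((DF x - DF a) v) \<le> w x * norm v"
      by (simp add: w_def sum_distrib_left sum_distrib_right mult.commute)
  qed
  show ?thesis
  proof (rule that[of d "DF a" F])
    show "d > 0" by fact
    show "linear (DF a)" using lin \<open>a \<in> S\<close> .
    show "torus_proj (F y) = f (torus_proj y)" if "y \<in> ball a d" for y
      unfolding F_def using that d(2) by (intro f_the_inv_into_f[OF inj]) (auto simp: S_def)
    fix e :: real assume "e > 0"
    have "\<exists>\<delta>>0. \<forall>x\<in>S. dist x a < \<delta> \<longrightarrow> dist (w x) (w a) < e"
      using contw \<open>a \<in> S\<close> \<open>e > 0\<close> unfolding continuous_on_iff by blast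
    then obtain \<delta> where \<delta>: "\<delta> > 0" "\<And>x. x \<in> S \<Longrightarrow> dist x a < \<delta> \<Longrightarrow> dist (w x) (w a) < e" by blast
    define \<eta> where "\<eta> = min d \<delta>"
    have sub: "ball a \<eta> \<subseteq> S" using d(2) by (auto simp: \<eta>_def)
    have "norm (F y - F z - DF a (y - z)) \<le> e * norm (y - z)"
      if "y \<in> ball a \<eta>" "z \<in> ball a \<eta>" for y z
    proof -
      have "norm (F y - F z - DF a (y - z)) \<le> norm (y - z) * e"
      proof (rule differentiable_bound_linearization[where S = "ball a \<eta>" and f' = DF])
        fix t :: real assume t: "t \<in> {0..1}"
        have "z + t *\<^sub>R (y - z) = (1 - t) *\<^sub>R z + t *\<^sub>R y" by (simp add: algebra_simps)
        then show "z + t *\<^sub>R (y - z) \<in> ball a \<eta>"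
          using convexD_alt[OF convex_ball that(2,1), of t] t by simp
      next
        fix x assume x: "x \<in> ball a \<eta>"
        then show "(F has_derivative DF x) (at x within ball a \<eta>)"
          using diff sub has_derivative_at_withinI by blast
        have "w a = 0" by (simp add: w_def)
        then have "w x < e" using \<delta>(2)[of x] x sub by (auto simp: \<eta>_def dist_commute)
        then show "onorm (DF x - DF a) \<le> e" using on[of x] x sub by force
      next
        show "a \<in> ball a \<eta>" using d(1) \<delta>(1) by (simp add: \<eta>_def)
      qed
      then show ?thesis by (simp add: mult.commute)
    qed
    then show "\<exists>\<delta>>0. \<delta> \<le> d \<and>
       (\<forall>y\<in>ball a \<delta>. \<forall>z\<in>ball a \<delta>. norm (F y - F z - DF a (y - z)) \<le> e * norm (y - z))"
      using d(1) \<delta>(1) by (intro exI[of _ \<eta>]) (auto simp: \<eta>_def)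
  qed
qed

text \<open>\<open>L\<close> depends on \<open>A\<close> only. The factor 1 is kept so that the
  premise matches the case \<open>e = 1\<close> of \<open>C1_strong_derivative\<close>.\<close>

lemma linear_close_lipschitz:
  fixes A :: "'a::euclidean_space \<Rightarrow> 'b::real_normed_vector"
  assumes "linear A"
  obtains L where "L > 0" "\<And>F y z. norm (F y - F z - A (y - z)) \<le> 1 * norm (y - z)
     \<Longrightarrow> norm (F y - F z) \<le> L * norm (y - z)"
proof -
  obtain B where B: "B > 0" "\<And>x. norm (A x) \<le> B * norm x" using linear_bounded_pos[OF assms] by blast
  show ?thesis
  proof (rule that[of "B + 1"])
    fix F y z assume "norm (F y - F z - A (y - z)) \<le> 1 * norm (y - z)"
    then show "norm (F y - F z) \<le> (B + 1) * norm (y - z)"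
      using B(2)[of "y - z"] norm_triangle_sub[of "F y - F z" "A (y - z)"] by (simp add: algebra_simps)
  qed (use B(1) in simp)
qed

lemma C1_locally_lipschitz:
  fixes f :: "'n::finite torus \<Rightarrow> 'n torus"
  assumes "torus_Ck 1 f"
  obtains L d where "L > 0" "d > 0" "\<And>y z. y \<in> ball x d \<Longrightarrow> z \<in> ball x d \<Longrightarrow> dist (f y) (f z) \<le> L * dist y z"
proof -
  obtain a where a: "x = torus_proj a" using surj_torus_proj by blast
  obtain F A d where F: "d > 0" "linear A" "\<And>y. y \<in> ball a d \<Longrightarrow> torus_proj (F y) = f (torus_proj y)"
    "\<And>e. e > 0 \<Longrightarrow> \<exists>\<delta>>0. \<delta> \<le> d \<and>
       (\<forall>y\<in>ball a \<delta>. \<forall>z\<in>ball a \<delta>. norm (F y - F z - A (y - z)) \<le> e * norm (y - z))"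
    using C1_strong_derivative[OF assms, of a] by metis
  obtain \<delta> where \<delta>: "\<delta> > 0" "\<delta> \<le> d"
     "\<And>y z. y\<in>ball a \<delta> \<Longrightarrow> z\<in>ball a \<delta> \<Longrightarrow> norm (F y - F z - A (y - z)) \<le> 1 * norm (y - z)"
    using F(4)[of 1] by (metis zero_less_one)
  obtain L where L: "L > 0" "\<And>F y z. norm (F y - F z - A (y - z)) \<le> 1 * norm (y - z)
     \<Longrightarrow> norm (F y - F z) \<le> L * norm (y - z)"
    using linear_close_lipschitz[OF F(2)] by metis
  show ?thesis
  proof (rule that[of L "min \<delta> (1/4)"])
    fix Y Z assume "Y \<in> ball x (min \<delta> (1/4))" "Z \<in> ball x (min \<delta> (1/4))"
    then obtain y z where y: "torus_proj y = Y" "dist a y < min \<delta> (1/4)"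
      and z: "torus_proj z = Z" "dist a z < min \<delta> (1/4)"
      unfolding a mem_ball by (metis torus_lift_near)
    have "dist y z \<le> 1/2" using y(2) z(2) dist_triangle_half_r[of a y "1/2" z] by simp
    then have "dist Y Z = norm (y - z)" using dist_torus_proj_eq y(1) z(1) by (metis dist_norm)
    moreover have "dist (f Y) (f Z) \<le> norm (F y - F z)"
      using dist_torus_proj_le[of "F y" "F z"] F(3)[of y] F(3)[of z] y z \<delta>(2) by (simp add: dist_norm)
    moreover have "norm (F y - F z) \<le> L * norm (y - z)" using L(2)[OF \<delta>(3)[of y z]] y z by simp
    ultimately show "dist (f Y) (f Z) \<le> L * dist Y Z" by simp
  qed (use \<delta> L in auto)
qed

text \<open>If a nearly linear map sends a ball onto a ball, its linear part is nearly a similarity.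
  The diameter along \<open>v\<close> has its image in a ball of diameter \<open>2 * r'\<close>,
  which bounds \<open>A v\<close> from above. Conversely the target diameter along
  \<open>A w\<close> comes from two points at distance at most \<open>2 * r\<close>, which bounds
  \<open>A w\<close> from below.\<close>

lemma ball_image_almost_conformal:
  fixes A F :: "'a::euclidean_space \<Rightarrow> 'a"
  assumes A: "linear A" "m > 0" "\<And>v. norm (A v) \<ge> m * norm v"
    and close: "\<And>y z. y \<in> cball c r \<Longrightarrow> z \<in> cball c r \<Longrightarrow> norm (F y - F z - A (y - z)) \<le> e * norm (y - z)"
    and F: "F ` cball c r = cball c' r'" "r > 0" "e > 0"
    and v: "norm v = 1" "norm w = 1"
  shows "norm (A v) - e \<le> norm (A w) * (1 + e / m)"
proof -
  have "c + r *\<^sub>R v \<in> cball c r" "c - r *\<^sub>R v \<in> cball c r" using v F(2) by (auto simp: dist_norm)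
  note p = this close[OF this]
  have df: "(c + r *\<^sub>R v) - (c - r *\<^sub>R v) = (2 * r) *\<^sub>R v" by (simp add: scaleR_left.add[symmetric] scaleR_2)
  have "F (c + r *\<^sub>R v) \<in> cball c' r'" "F (c - r *\<^sub>R v) \<in> cball c' r'" using p F(1) by auto
  then have d: "norm (F (c + r *\<^sub>R v) - F (c - r *\<^sub>R v)) \<le> 2 * r'"
    using dist_triangle2[of "F (c + r *\<^sub>R v)" "F (c - r *\<^sub>R v)" c'] by (simp add: dist_norm norm_minus_commute)
  have "norm (A ((2 * r) *\<^sub>R v)) \<le> 2 * r' + e * (2 * r)"
    using p(3) d norm_triangle_sub[of "A ((2*r) *\<^sub>R v)" "F (c + r *\<^sub>R v) - F (c - r *\<^sub>R v)"] v F(2)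
    by (simp add: df norm_minus_commute)
  then have 1: "r * (norm (A v) - e) \<le> r'"
    using F(2) by (simp add: linear_scale[OF A(1)] algebra_simps)
  have Aw: "norm (A w) > 0"
    using less_le_trans[OF A(2)] A(3)[of w] v(2) by (metis mult.right_neutral)
  define u where "u = (1 / norm (A w)) *\<^sub>R A w"
  have u: "norm u = 1" using Aw by (simp add: u_def)
  have "F c \<in> cball c' r'" using F(1,2) by auto
  then have r': "r' \<ge> 0" using dist_not_less_zero order_trans by (metis mem_cball zero_le_dist)
  have "c' + r' *\<^sub>R u \<in> cball c' r'" "c' - r' *\<^sub>R u \<in> cball c' r'" using u r' by (auto simp: dist_norm)
  then obtain x y where xy: "x \<in> cball c r" "y \<in> cball c r" "F x = c' + r' *\<^sub>R u" "F y = c' - r' *\<^sub>R u"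
    using F(1) by (metis imageE)
  have nxy: "norm (x - y) \<le> 2 * r" using xy dist_triangle2[of x y c] by (simp add: dist_norm norm_minus_commute)
  \<comment> \<open>With this \<open>t\<close>, the vector \<open>A (t *\<^sub>R w)\<close> is
    exactly the target diameter along \<open>A w\<close>, so \<open>t *\<^sub>R w\<close> is close
    to \<open>x - y\<close>.\<close>
  define t where "t = 2 * r' / norm (A w)"
  have t: "t \<ge> 0" "t * norm (A w) = 2 * r'" using r' Aw by (auto simp: t_def)
  have "F x - F y = (2 * r') *\<^sub>R u" by (simp add: xy scaleR_left.add[symmetric] scaleR_2)
  also have "\<dots> = A (t *\<^sub>R w)" by (simp add: u_def t_def linear_scale[OF A(1)])
  finally have "norm (A (t *\<^sub>R w) - A (x - y)) \<le> e * norm (x - y)" using close[OF xy(1,2)] by simp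
  then have "norm (A (t *\<^sub>R w - (x - y))) \<le> e * (2 * r)"
    using nxy F(3) linear_diff[OF A(1)] by (smt (verit) mult_left_mono)
  then have "m * norm (t *\<^sub>R w - (x - y)) \<le> e * (2 * r)" using A(3) order_trans by blast
  then have "norm (t *\<^sub>R w - (x - y)) \<le> e * (2 * r) / m" using A(2) by (simp add: field_simps)
  then have "t \<le> 2 * r + e * (2 * r) / m"
    using norm_triangle_sub[of "t *\<^sub>R w" "x - y"] nxy v(2) t(1) by simp
  then have "2 * r' \<le> (2 * r + e * (2 * r) / m) * norm (A w)"
    using t(2) Aw by (metis mult_right_mono less_imp_le)
  moreover have "(2 * r + e * (2 * r) / m) * norm (A w) = 2 * (r * (norm (A w) * (1 + e / m)))"
    using A(2) by (simp add: field_simps)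
  ultimately have "r' \<le> r * (norm (A w) * (1 + e / m))" by linarith
  then have "r * (norm (A v) - e) \<le> r * (norm (A w) * (1 + e / m))" using 1 by linarith
  then show ?thesis using F(2) by simp
qed

lemma torus_proj_cball_radius_le:
  fixes c :: "real ^ 'n::finite"
  assumes "\<And>x y. x \<in> torus_proj ` cball c r \<Longrightarrow> y \<in> torus_proj ` cball c r \<Longrightarrow> dist x y < D" "D \<le> 1/2" "D > 0"
  shows "r < D"
proof (rule ccontr)
  assume r: "\<not> r < D"
  define e :: "real ^ 'n" where "e = axis undefined 1"
  have e: "norm e = 1" unfolding e_def by (rule norm_axis_1)
  have "c \<in> cball c r" "c + D *\<^sub>R e \<in> cball c r" using r assms(3) e by (auto simp: dist_norm)
  then have "dist (torus_proj c) (torus_proj (c + D *\<^sub>R e)) < D" using assms(1) by blast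
  moreover have "dist c (c + D *\<^sub>R e) = D" using assms(3) e by (simp add: dist_norm)
  ultimately show False using dist_torus_proj_eq[of c "c + D *\<^sub>R e"] assms(2) by simp
qed

lemma torus_proj_cball_translate:
  assumes "torus_proj c = torus_proj c0"
  shows "torus_proj ` cball c r = torus_proj ` cball c0 r"
proof -
  have *: "torus_proj ` cball c r \<subseteq> torus_proj ` cball c0 r" if "torus_proj c = torus_proj c0" for c c0
  proof (rule image_subsetI)
    fix x assume x: "x \<in> cball c r"
    have "x + (c0 - c) \<in> cball c0 r" using x by (simp add: dist_norm algebra_simps)
    moreover have "torus_proj (x + (c0 - c)) = torus_proj x"
      using that[symmetric] by (simp add: torus_proj_eq_iff)
    ultimately show "torus_proj x \<in> torus_proj ` cball c0 r" by (metis image_eqI)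
  qed
  show ?thesis using *[of c c0] *[of c0 c] assms by auto
qed

text \<open>A similarity of ratio \<open>l\<close> up to the factor \<open>K\<close>. The ratio may
  change from one set to another, whereas \<open>K\<close> is meant to be common to all of
  them.\<close>

definition lin_distort :: "real \<Rightarrow> real \<Rightarrow> ('a::metric_space \<Rightarrow> 'b::metric_space) \<Rightarrow> 'a set \<Rightarrow> bool" where
  "lin_distort K l g S \<longleftrightarrow> (\<forall>y\<in>S. \<forall>z\<in>S. l * dist y z \<le> dist (g y) (g z) \<and> dist (g y) (g z) \<le> K * l * dist y z)"

lemma lin_distort_mono: "lin_distort K l g S \<Longrightarrow> S' \<subseteq> S \<Longrightarrow> lin_distort K l g S'"
  unfolding lin_distort_def by blast

section \<open>Conformality of \<open>f\<close> at points that are not interior to a fibre\<close>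

context round_fibres
begin

text \<open>The local Lipschitz bound of \<open>inv f\<close>, read backwards.\<close>

lemma f_locally_expansive:
  obtains m d where "m > 0" "d > 0"
    "\<And>y z. y \<in> ball x d \<Longrightarrow> z \<in> ball x d \<Longrightarrow> m * dist y z \<le> dist (f y) (f z)"
proof -
  obtain L d where L: "L > 0" "d > 0"
    "\<And>y z. y \<in> ball (f x) d \<Longrightarrow> z \<in> ball (f x) d \<Longrightarrow> dist (inv f y) (inv f z) \<le> L * dist y z"
    using C1_locally_lipschitz[OF C1_inv_f, of "f x"] by metis
  obtain d' where d': "d' > 0" "\<And>y. dist y x < d' \<Longrightarrow> dist (f y) (f x) < d"
    using cont_f L(2) unfolding continuous_on_iff by (metis UNIV_I)
  show ?thesis
  proof (rule that[of "1/L" d'])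
    fix y z assume "y \<in> ball x d'" "z \<in> ball x d'"
    then have "dist y z \<le> L * dist (f y) (f z)" using L(3)[of "f y" "f z"] d'(2)[of y] d'(2)[of z] by (simp add: dist_commute)
    then show "1/L * dist y z \<le> dist (f y) (f z)" using L(1) by (simp add: field_simps)
  qed (use L d' in auto)
qed

text \<open>Lifts the equality between the image of a small ball fibre and another ball fibre from
  the torus to an equality of round balls in space, as \<open>ball_image_almost_conformal\<close>
  requires.\<close>

lemma small_ball_lift:
  assumes nonint: "\<And>e q. e > 0 \<Longrightarrow> \<not> ball (torus_proj a) e \<subseteq> fibre q"
    and "d > 0" "d \<le> 1/8"
    and F: "\<And>y. y \<in> ball a d \<Longrightarrow> torus_proj (F y) = f (torus_proj y)"
      "\<And>y z. y \<in> ball a d \<Longrightarrow> z \<in> ball a d \<Longrightarrow> dist (F y) (F z) < 1/8"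
  obtains c r c' r' where "r > 0" "cball c r \<subseteq> ball a d" "F ` cball c r = cball c' r'"
proof -
  obtain q where q: "euclidean_ball (fibre q)" "fibre q \<subseteq> ball (torus_proj a) (d/4)"
    using small_ball_fibres[of "torus_proj a" "d/4"] nonint \<open>d > 0\<close> by auto
  obtain c0 r where c0: "0 < r" "fibre q = torus_proj ` cball c0 r" using q(1) by (rule euclidean_ballE)
  have "torus_proj c0 \<in> fibre q" using c0 by auto
  then have "dist (torus_proj a) (torus_proj c0) < d/4" using q(2) by auto
  then obtain c where c: "torus_proj c = torus_proj c0" "dist a c < d/4" by (rule torus_lift_near)
  have fq: "fibre q = torus_proj ` cball c r" using torus_proj_cball_translate[OF c(1)] c0(2) by simp
  have "r < d/2"
  proof (rule torus_proj_cball_radius_le)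
    fix x y assume "x \<in> torus_proj ` cball c r" "y \<in> torus_proj ` cball c r"
    then have "x \<in> ball (torus_proj a) (d/4)" "y \<in> ball (torus_proj a) (d/4)" using q(2) unfolding fq by blast+
    then show "dist x y < d/2" using dist_triangle_half_r[of "torus_proj a" x "d/2" y] by simp
  qed (use assms in auto)
  have sub: "cball c r \<subseteq> ball a d"
  proof
    fix x assume "x \<in> cball c r"
    then show "x \<in> ball a d" using c(2) \<open>r < d/2\<close> dist_triangle[of a x c] \<open>d > 0\<close> by simp
  qed
  have cc: "c \<in> cball c r" using c0(1) by simp
  have "euclidean_ball (fibre (q + \<theta>))" using q(1) ball_fibre_shift by simp
  then obtain c1 r' where c1: "fibre (q + \<theta>) = torus_proj ` cball c1 r'" by (rule euclidean_ballE)
  have img: "fibre (q + \<theta>) = torus_proj ` F ` cball c r"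
    unfolding fibre_image[symmetric] fq image_image using F(1) sub by (intro image_cong) auto
  have "torus_proj (F c) \<in> torus_proj ` cball c1 r'" using img c1 cc by blast
  then obtain u where u: "u \<in> cball c1 r'" "torus_proj (F c) = torus_proj u" by blast
  \<comment> \<open>The target ball is known only modulo the lattice. The translation by
    \<open>F c - u\<close> selects the lift that contains \<open>F c\<close>.\<close>
  define c' where "c' = c1 + (F c - u)"
  have "F c - u \<in> int_lattice" using u(2) by (simp add: torus_proj_eq_iff)
  then have "torus_proj c' = torus_proj c1" by (simp add: c'_def torus_proj_eq_iff)
  then have img': "torus_proj ` F ` cball c r = torus_proj ` cball c' r'"
    using torus_proj_cball_translate img c1 by metis
  have Fc: "F c \<in> cball c' r'" using u(1) by (simp add: c'_def dist_norm algebra_simps)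
  have r': "r' < 1/8"
  proof (rule torus_proj_cball_radius_le)
    fix x y assume "x \<in> torus_proj ` cball c' r'" "y \<in> torus_proj ` cball c' r'"
    then obtain x' y' where "x = torus_proj (F x')" "x' \<in> cball c r" "y = torus_proj (F y')" "y' \<in> cball c r"
      unfolding img'[symmetric] by blast
    then show "dist x y < 1/8" using dist_torus_proj_le F(2) sub by (meson order_le_less_trans subsetD)
  qed auto
  \<comment> \<open>Points with the same projection coincide once their distance is at most 1/2;
    here it is at most 1/8 plus twice a radius below 1/8.\<close>
  have key: "F x = v" if x: "x \<in> cball c r" and v: "v \<in> cball c' r'" "torus_proj (F x) = torus_proj v" for x v
  proof -
    have "dist (F x) (F c) < 1/8" using F(2) sub x cc by blast
    moreover have "dist (F c) v \<le> 2 * r'"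
      using Fc v(1) dist_triangle[of "F c" v c'] by (simp add: dist_commute)
    ultimately have "dist (F x) v \<le> 1/2" using r' dist_triangle[of "F x" v "F c"] by simp
    from dist_torus_proj_eq[OF this] v(2) show ?thesis by simp
  qed
  have "F ` cball c r = cball c' r'"
  proof (intro antisym image_subsetI subsetI)
    fix x assume x: "x \<in> cball c r"
    then have "torus_proj (F x) \<in> torus_proj ` cball c' r'" using img' by blast
    then show "F x \<in> cball c' r'" using key[OF x] by fastforce
  next
    fix v assume v: "v \<in> cball c' r'"
    then have "torus_proj v \<in> torus_proj ` F ` cball c r" using img' by blast
    then show "v \<in> F ` cball c r" using key[OF _ v] by fastforce
  qed
  then show ?thesis using that c0(1) sub by blast
qed

text \<open>Ball fibres accumulate at \<open>x\<close> and are mapped to balls. As they shrink, the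
  error in \<open>ball_image_almost_conformal\<close> tends to 0, so \<open>A\<close> has the same
  norm on all unit vectors. A map close to a similarity then has distortion \<open>K\<close> at a
  small scale.\<close>

lemma f_conformal_off_interior:
  assumes nonint: "\<And>e q. e > 0 \<Longrightarrow> \<not> ball x e \<subseteq> fibre q" and "K > 1"
  shows "\<exists>d>0. \<exists>l>0. lin_distort K l f (ball x d)"
proof -
  obtain a where a: "x = torus_proj a" using surj_torus_proj by blast
  obtain F A d where F: "d > 0" "linear A" "\<And>y. y \<in> ball a d \<Longrightarrow> torus_proj (F y) = f (torus_proj y)"
    "\<And>e. e > 0 \<Longrightarrow> \<exists>\<delta>>0. \<delta> \<le> d \<and>
       (\<forall>y\<in>ball a \<delta>. \<forall>z\<in>ball a \<delta>. norm (F y - F z - A (y - z)) \<le> e * norm (y - z))"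
    using C1_strong_derivative[OF C1_f, of a] by metis
  obtain m d1 where m: "m > 0" "d1 > 0"
    "\<And>y z. y \<in> ball x d1 \<Longrightarrow> z \<in> ball x d1 \<Longrightarrow> m * dist y z \<le> dist (f y) (f z)"
    using f_locally_expansive[of x] by metis
  obtain d2 where d2: "d2 > 0" "d2 \<le> d"
     "\<And>y z. y\<in>ball a d2 \<Longrightarrow> z\<in>ball a d2 \<Longrightarrow> norm (F y - F z - A (y - z)) \<le> 1 * norm (y - z)"
    using F(4)[of 1] by (metis zero_less_one)
  obtain L where L: "L > 0" "\<And>F y z. norm (F y - F z - A (y - z)) \<le> 1 * norm (y - z)
     \<Longrightarrow> norm (F y - F z) \<le> L * norm (y - z)"
    using linear_close_lipschitz[OF F(2)] by metis
  \<comment> \<open>The bound \<open>1/(16 * L)\<close> keeps the image under \<open>F\<close> below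
    diameter 1/8, so that the projection is isometric at the source and at the target.\<close>
  define d3 where "d3 = Min {d1, d2, 1/8, 1/(16 * L)}"
  have d3: "d3 > 0" "d3 \<le> d1" "d3 \<le> d2" "d3 \<le> 1/8" "d3 \<le> 1/(16 * L)"
    using m d2 L by (auto simp: d3_def)
  have close: "dist y z < 2 * d3" if "y \<in> ball a d3" "z \<in> ball a d3" for y z
    using that dist_triangle_half_r[of a y "2 * d3" z] by simp
  have Fsmall: "dist (F y) (F z) < 1/8" if "y \<in> ball a d3" "z \<in> ball a d3" for y z
  proof -
    have "dist (F y) (F z) \<le> L * dist y z"
      using L(2)[OF d2(3)[of y z]] that d3 by (simp add: dist_norm)
    also have "\<dots> < L * (2 * d3)" using close[OF that] L(1) by simp
    also have "\<dots> \<le> 1/8" using d3(5) L(1) by (simp add: field_simps)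
    finally show ?thesis .
  qed
  have dsrc: "dist (torus_proj y) (torus_proj z) = norm (y - z)" if "y \<in> ball a d3" "z \<in> ball a d3" for y z
    using dist_torus_proj_eq[of y z] close[OF that] d3(4) by (simp add: dist_norm)
  have dtgt: "dist (f (torus_proj y)) (f (torus_proj z)) = norm (F y - F z)"
    if "y \<in> ball a d3" "z \<in> ball a d3" for y z
    using dist_torus_proj_eq[of "F y" "F z"] Fsmall[OF that] F(3)[of y] F(3)[of z] that d3 d2(2) by (simp add: dist_norm)
  have proj_in: "torus_proj y \<in> ball x d3" if "y \<in> ball a d3" for y
    using that torus_proj_ball[of a d3] unfolding a by blast
  have expand: "m * norm (y - z) \<le> norm (F y - F z)" if "y \<in> ball a d3" "z \<in> ball a d3" for y z
    using m(3)[of "torus_proj y" "torus_proj z"] proj_in[OF that(1)] proj_in[OF that(2)] d3(2)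
    by (simp add: dsrc[OF that] dtgt[OF that])
  have lower1: "norm (A v) \<ge> m" if v: "norm v = 1" for v
  proof (rule field_le_epsilon)
    fix e :: real assume "e > 0"
    then obtain \<delta> where \<delta>: "\<delta> > 0" "\<And>y z. y\<in>ball a \<delta> \<Longrightarrow> z\<in>ball a \<delta> \<Longrightarrow> norm (F y - F z - A (y - z)) \<le> e * norm (y - z)"
      using F(4)[of e] by metis
    define t where "t = min \<delta> d3 / 2"
    have t: "t > 0" "t < \<delta>" "t < d3" using \<delta>(1) d3(1) by (auto simp: t_def)
    have b: "a + t *\<^sub>R v \<in> ball a \<delta>" "a + t *\<^sub>R v \<in> ball a d3" "a \<in> ball a \<delta>" "a \<in> ball a d3"
      using t v by (auto simp: dist_norm)
    have "m * t \<le> norm (F (a + t *\<^sub>R v) - F a)" using expand[OF b(2,4)] t v by simp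
    also have "\<dots> \<le> norm (A (t *\<^sub>R v)) + e * t"
      using \<delta>(2)[OF b(1,3)] norm_triangle_sub[of "F (a + t *\<^sub>R v) - F a" "A (t *\<^sub>R v)"] t v by simp
    also have "\<dots> = (norm (A v) + e) * t" using t by (simp add: linear_scale[OF F(2)] algebra_simps)
    finally show "m \<le> norm (A v) + e" using t(1) by simp
  qed
  have lower: "norm (A v) \<ge> m * norm v" for v
  proof (cases "v = 0")
    case False
    then show ?thesis using lower1[of "(1 / norm v) *\<^sub>R v"]
      by (simp add: linear_scale[OF F(2)] field_simps)
  qed (simp add: linear_0[OF F(2)])
  have le: "norm (A v) \<le> norm (A w)" if vw: "norm v = 1" "norm w = 1" for v w
  proof -
    have bound: "norm (A v) - e \<le> norm (A w) * (1 + e / m)" if e: "e > 0" for e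
    proof -
      obtain \<delta> where \<delta>: "\<delta> > 0" "\<And>y z. y\<in>ball a \<delta> \<Longrightarrow> z\<in>ball a \<delta> \<Longrightarrow> norm (F y - F z - A (y - z)) \<le> e * norm (y - z)"
        using F(4)[OF e] by metis
      define h where "h = min \<delta> d3"
      have h: "h > 0" "h \<le> \<delta>" "h \<le> d3" using \<delta>(1) d3(1) by (auto simp: h_def)
      obtain c r c' r' where c: "r > 0" "cball c r \<subseteq> ball a h" "F ` cball c r = cball c' r'"
      proof (rule small_ball_lift[of a h F])
        show "\<not> ball (torus_proj a) e \<subseteq> fibre q" if "e > 0" for e q using nonint that a by simp
        show "torus_proj (F y) = f (torus_proj y)" if "y \<in> ball a h" for y
          using F(3) that h(3) d3(3) d2(2) by simp
        show "dist (F y) (F z) < 1/8" if "y \<in> ball a h" "z \<in> ball a h" for y z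
          using Fsmall that h(3) by simp
      qed (use h d3 in auto)
      have "cball c r \<subseteq> ball a \<delta>" using c(2) subset_ball[OF h(2)] by blast
      then show ?thesis
        using ball_image_almost_conformal[OF F(2) m(1) lower _ c(3,1) e vw] \<delta>(2) by blast
    qed
    have "norm (A v) \<le> norm (A w) + e" if e: "e > 0" for e
    proof -
      define \<epsilon> where "\<epsilon> = e / (1 + norm (A w) / m)"
      have pos: "1 + norm (A w) / m > 0" using m(1) by (simp add: add_pos_nonneg)
      then have "\<epsilon> > 0" using e by (simp add: \<epsilon>_def)
      have "norm (A v) \<le> norm (A w) + \<epsilon> * (1 + norm (A w) / m)"
        using bound[OF \<open>\<epsilon> > 0\<close>] by (simp add: algebra_simps)
      then show ?thesis using pos by (simp add: \<epsilon>_def)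
    qed
    then show ?thesis by (rule field_le_epsilon)
  qed
  define v0 :: "real ^ 'n" where "v0 = axis undefined 1"
  have v0: "norm v0 = 1" unfolding v0_def by (rule norm_axis_1)
  define l where "l = norm (A v0)"
  have l: "l > 0" unfolding l_def using lower1[OF v0] m(1) by linarith
  have conf: "norm (A v) = l * norm v" for v
  proof (cases "v = 0")
    case False
    then have n: "norm ((1 / norm v) *\<^sub>R v) = 1" by simp
    have "norm (A ((1 / norm v) *\<^sub>R v)) = l" unfolding l_def using le[OF n v0] le[OF v0 n] by simp
    then show ?thesis using False by (simp add: linear_scale[OF F(2)] field_simps)
  qed (simp add: linear_0[OF F(2)])
  \<comment> \<open>The solution of \<open>l + e = K * (l - e)\<close>: an error \<open>e\<close>
    around the ratio \<open>l\<close> is exactly distortion \<open>K\<close>.\<close>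
  define e where "e = l * (K - 1) / (K + 1)"
  have e: "e > 0" using l \<open>K > 1\<close> by (simp add: e_def)
  have le: "l - e = 2 * l / (K + 1)" "l + e = K * (l - e)" using \<open>K > 1\<close> by (auto simp: e_def field_simps)
  obtain \<delta> where \<delta>: "\<delta> > 0" "\<And>y z. y\<in>ball a \<delta> \<Longrightarrow> z\<in>ball a \<delta> \<Longrightarrow> norm (F y - F z - A (y - z)) \<le> e * norm (y - z)"
    using F(4)[OF e] by metis
  have "lin_distort K (l - e) f (ball x (min \<delta> d3))"
    unfolding lin_distort_def
  proof (intro ballI)
    fix Y Z assume "Y \<in> ball x (min \<delta> d3)" "Z \<in> ball x (min \<delta> d3)"
    then obtain y z where y: "torus_proj y = Y" "dist a y < min \<delta> d3"
      and z: "torus_proj z = Z" "dist a z < min \<delta> d3"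
      unfolding a mem_ball by (metis torus_lift_near)
    then have yz: "y \<in> ball a d3" "z \<in> ball a d3" "y \<in> ball a \<delta>" "z \<in> ball a \<delta>" by auto
    have "norm (F y - F z - A (y - z)) \<le> e * norm (y - z)" using \<delta>(2) yz by blast
    then have "\<bar>norm (F y - F z) - l * norm (y - z)\<bar> \<le> e * norm (y - z)"
      using norm_triangle_ineq3[of "F y - F z" "A (y - z)"] by (simp add: conf)
    then have "(l - e) * norm (y - z) \<le> norm (F y - F z)" "norm (F y - F z) \<le> (l + e) * norm (y - z)"
      by (auto simp: algebra_simps abs_le_iff)
    then show "(l - e) * dist Y Z \<le> dist (f Y) (f Z) \<and> dist (f Y) (f Z) \<le> K * (l - e) * dist Y Z"
      using dsrc[OF yz(1,2)] dtgt[OF yz(1,2)] by (simp add: y(1) z(1) le(2))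
  qed
  moreover have "l - e > 0" using le(1) l \<open>K > 1\<close> by simp
  moreover have "min \<delta> d3 > 0" using \<delta>(1) d3(1) by simp
  ultimately show ?thesis by blast
qed

section \<open>Quasiconformality of the iterates at small scales\<close>

definition quasiconformal :: "real \<Rightarrow> ('n torus \<Rightarrow> 'n torus) \<Rightarrow> bool" where
  "quasiconformal K g \<longleftrightarrow> (\<exists>d>0. \<forall>x. (\<exists>q. ball x d \<subseteq> fibre q) \<or> (\<exists>l>0. lin_distort K l g (ball x d)))"

text \<open>The local radii are made uniform by a Lebesgue number of the cover by good
  balls.\<close>

lemma quasiconformal_f:
  assumes "K > 1"
  shows "quasiconformal K f"
proof -
  let ?good = "\<lambda>S. (\<exists>q. S \<subseteq> fibre q) \<or> (\<exists>l>0. lin_distort K l f S)"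
  have "\<exists>d>0. ?good (ball x d)" for x
    using f_conformal_off_interior[of x K] assms by blast
  then obtain d where d: "\<And>x. d x > 0" "\<And>x. ?good (ball x (d x))" by metis
  obtain e where e: "e > 0" "\<And>x :: 'n torus. \<exists>G\<in>range (\<lambda>x. ball x (d x)). ball x e \<subseteq> G"
  proof (rule Heine_Borel_lemma[OF compact_torus, of "range (\<lambda>x. ball x (d x))"])
    show "UNIV \<subseteq> \<Union> (range (\<lambda>x. ball x (d x)))" using d(1) by (auto intro!: exI simp: dist_self)
  qed auto
  have "?good (ball x e)" for x
  proof -
    obtain y where "ball x e \<subseteq> ball y (d y)" using e(2)[of x] by blast
    then show ?thesis using d(2)[of y] lin_distort_mono by (meson subset_trans)
  qed
  then show ?thesis unfolding quasiconformal_def using e(1) by blast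
qed

text \<open>Ratios and distortions multiply on a common small ball. If the alternative of
  \<open>g\<close> at \<open>f x\<close> is a fibre, the semiconjugacy pulls it back to a
  fibre.\<close>

lemma quasiconformal_compose:
  assumes "quasiconformal K f" "quasiconformal K' g" "K' > 0"
  shows "quasiconformal (K' * K) (\<lambda>x. g (f x))"
proof -
  obtain d where d: "d > 0" "\<And>x. (\<exists>q. ball x d \<subseteq> fibre q) \<or> (\<exists>l>0. lin_distort K l f (ball x d))"
    using assms(1) unfolding quasiconformal_def by blast
  obtain d' where d': "d' > 0" "\<And>x. (\<exists>q. ball x d' \<subseteq> fibre q) \<or> (\<exists>l>0. lin_distort K' l g (ball x d'))"
    using assms(2) unfolding quasiconformal_def by blast
  have "uniformly_continuous_on UNIV f" using compact_uniformly_continuous cont_f compact_torus by blast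
  then obtain h where h: "h > 0" "\<And>x y. dist y x < h \<Longrightarrow> dist (f y) (f x) < d'"
    using d'(1) unfolding uniformly_continuous_on_def by (metis UNIV_I)
  define e where "e = min d h"
  have e: "e > 0" "e \<le> d" "e \<le> h" using d(1) h(1) by (auto simp: e_def)
  have im: "f y \<in> ball (f x) d'" if "y \<in> ball x e" for x y using h(2)[of y x] that e(3) by (simp add: dist_commute)
  have "(\<exists>q. ball x e \<subseteq> fibre q) \<or> (\<exists>l>0. lin_distort (K' * K) l (\<lambda>x. g (f x)) (ball x e))" for x
  proof -
    consider q where "ball x d \<subseteq> fibre q" | q where "ball (f x) d' \<subseteq> fibre q"
      | l l' where "l > 0" "lin_distort K l f (ball x d)" "l' > 0" "lin_distort K' l' g (ball (f x) d')"
      using d(2)[of x] d'(2)[of "f x"] by blast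
    then show ?thesis
    proof cases
      case 1
      then show ?thesis using subset_ball[OF e(2)] by (meson subset_trans)
    next
      case 2
      have "ball x e \<subseteq> fibre (q - \<theta>)"
      proof
        fix y assume "y \<in> ball x e"
        then have "\<phi> y + \<theta> = q" using im 2 semiconj by fastforce
        then show "y \<in> fibre (q - \<theta>)" by auto
      qed
      then show ?thesis by blast
    next
      case 3
      have "lin_distort (K' * K) (l * l') (\<lambda>x. g (f x)) (ball x e)"
        unfolding lin_distort_def
      proof (intro ballI conjI)
        fix y z assume yz: "y \<in> ball x e" "z \<in> ball x e"
        then have a: "l * dist y z \<le> dist (f y) (f z)" "dist (f y) (f z) \<le> K * l * dist y z"
          using 3(2) e(2) unfolding lin_distort_def by auto
        have b: "l' * dist (f y) (f z) \<le> dist (g (f y)) (g (f z))" "dist (g (f y)) (g (f z)) \<le> K' * l' * dist (f y) (f z)"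
          using 3(4) im yz unfolding lin_distort_def by blast+
        show "l * l' * dist y z \<le> dist (g (f y)) (g (f z))"
          using order_trans[OF mult_left_mono[OF a(1), of l'] b(1)] 3(3) by (simp add: mult_ac)
        show "dist (g (f y)) (g (f z)) \<le> K' * K * (l * l') * dist y z"
          using order_trans[OF b(2) mult_left_mono[OF a(2), of "K' * l'"]] 3(3) assms(3) by (simp add: mult_ac)
      qed
      then show ?thesis using 3 by (meson mult_pos_pos)
    qed
  qed
  then show ?thesis unfolding quasiconformal_def using e(1) by blast
qed

text \<open>The induction is over all \<open>K > 1\<close> at once: \<open>f\<close> and the shorter
  iterate are each given the constant \<open>sqrt K\<close>, so the product does not grow with
  \<open>n\<close>.\<close>

lemma quasiconformal_funpow:
  assumes "K > 1"
  shows "quasiconformal K (f ^^ n)"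
  using assms
proof (induction n arbitrary: K)
  case 0
  have "lin_distort K 1 (f ^^ 0) S" for S
    using 0 mult_right_mono[of 1 K] unfolding lin_distort_def by auto
  then show ?case unfolding quasiconformal_def by (meson zero_less_one)
next
  case (Suc n)
  have s: "sqrt K > 1" "sqrt K * sqrt K = K" using Suc.prems by auto
  have "quasiconformal (sqrt K * sqrt K) (\<lambda>x. (f ^^ n) (f x))"
    using quasiconformal_compose[OF quasiconformal_f[OF s(1)] Suc.IH[OF s(1)]] s(1) by simp
  moreover have "(\<lambda>x. (f ^^ n) (f x)) = f ^^ Suc n" by (simp only: funpow_Suc_right comp_def)
  ultimately show ?case using s(2) by metis
qed

end

section \<open>Packing and crossing estimates\<close>

text \<open>Everything lies within 1/4 of \<open>torus_proj a\<close>, so the balls lift to disjoint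
  balls of space inside \<open>S\<close>, and volumes add up.\<close>

lemma torus_packing:
  fixes x :: "'i \<Rightarrow> 'n::finite torus" and a :: "real ^ 'n"
  assumes "finite I" and r: "\<And>i. i \<in> I \<Longrightarrow> r i > 0"
    and near: "\<And>i. i \<in> I \<Longrightarrow> dist (torus_proj a) (x i) + r i < 1/4"
    and disj: "\<And>i j. i \<in> I \<Longrightarrow> j \<in> I \<Longrightarrow> i \<noteq> j \<Longrightarrow> ball (x i) (r i) \<inter> ball (x j) (r j) = {}"
    and S: "S \<in> fmeasurable lborel"
    and sub: "\<And>i z. i \<in> I \<Longrightarrow> z \<in> ball a (1/4) \<Longrightarrow> torus_proj z \<in> ball (x i) (r i) \<Longrightarrow> z \<in> S"
  shows "(\<Sum>i\<in>I. r i ^ CARD('n)) * unit_ball_vol CARD('n) \<le> measure lborel S"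
proof -
  have "\<exists>y. torus_proj y = x i \<and> dist a y < 1/4 - r i" if "i \<in> I" for i
    using torus_lift_near[of a "x i" "1/4 - r i"] near[OF that] by (metis less_diff_eq)
  then obtain y where y: "\<And>i. i \<in> I \<Longrightarrow> torus_proj (y i) = x i" "\<And>i. i \<in> I \<Longrightarrow> dist a (y i) < 1/4 - r i"
    by metis
  define B where "B = (\<lambda>i. ball (y i) (r i))"
  have proj: "torus_proj z \<in> ball (x i) (r i)" if "i \<in> I" "z \<in> B i" for i z
    using that(2) y(1)[OF that(1)] torus_proj_ball[of "y i" "r i"] unfolding B_def by auto
  have "B i \<subseteq> S" if i: "i \<in> I" for i
  proof
    fix z assume z: "z \<in> B i"
    have "z \<in> ball a (1/4)" using z y(2)[OF i] dist_triangle[of a z "y i"] by (simp add: B_def)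
    then show "z \<in> S" using sub[OF i] proj[OF i z] by blast
  qed
  then have US: "(\<Union>i\<in>I. B i) \<subseteq> S" by blast
  have "disjoint_family_on B I"
    unfolding disjoint_family_on_def using disj proj by blast
  then have "measure lborel (\<Union>i\<in>I. B i) = (\<Sum>i\<in>I. measure lborel (B i))"
    using assms(1) by (intro measure_finite_Union) (auto simp: B_def less_top emeasure_lborel_ball_finite[unfolded infinity_ennreal_def])
  also have "\<dots> = (\<Sum>i\<in>I. r i ^ CARD('n) * unit_ball_vol CARD('n))"
    by (intro sum.cong refl) (use r in \<open>auto simp: B_def content_ball less_imp_le mult.commute\<close>)
  finally show ?thesis
    using measure_mono_fmeasurable[OF US _ S] assms(1)
    by (simp add: sum_distrib_right B_def sets.finite_UN)
qed

text \<open>Moving \<open>y\<close> towards the centre by the fraction \<open>s / r\<close> gives an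
  inscribed ball of radius \<open>s\<close> near \<open>y\<close>. This replaces a ball that may be
  large by a piece of it near a given point.\<close>

lemma torus_proj_cball_subball:
  assumes "y \<in> torus_proj ` cball c r" "0 < s" "s \<le> r"
  obtains x where "ball x s \<subseteq> torus_proj ` cball c r" "dist x y \<le> s"
proof -
  obtain b where b: "y = torus_proj b" "b \<in> cball c r" using assms(1) by blast
  define a where "a = b + (s / r) *\<^sub>R (c - b)"
  have "dist a b = s / r * dist c b" using assms by (simp add: a_def dist_norm)
  also have "\<dots> \<le> s / r * r" using b(2) assms by (intro mult_left_mono) auto
  finally have ab: "dist a b \<le> s" using assms by simp
  have "dist c a = norm ((1 - s / r) *\<^sub>R (c - b))" by (simp add: a_def dist_norm algebra_simps)
  also have "\<dots> \<le> (1 - s / r) * r"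
    using b(2) assms by (simp add: dist_norm mult_left_mono)
  also have "\<dots> = r - s" using assms by (simp add: field_simps)
  finally have "ball a s \<subseteq> cball c r"
    using dist_triangle_less_add order.strict_iff_order by (intro subsetI) (smt (verit) dist_triangle mem_ball mem_cball)
  then have "ball (torus_proj a) s \<subseteq> torus_proj ` cball c r"
    unfolding torus_proj_ball[symmetric] by (rule image_mono)
  moreover have "dist (torus_proj a) y \<le> s" using ab dist_torus_proj_le order_trans b(1) by blast
  ultimately show ?thesis by (rule that)
qed

text \<open>By the intermediate value theorem \<open>\<psi>\<close> takes all values in [0, 1]. The
  intervals of radius \<open>osc j\<close> around one value from each visited set cover them, and
  each has length \<open>2 * osc j\<close>.\<close>

lemma osc_sum_ge_1:
  fixes \<psi> :: "real \<Rightarrow> real"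
  assumes "a \<le> b" "continuous_on {a..b} \<psi>" "\<psi> a = 0" "\<psi> b = 1" "finite J"
    and osc: "\<And>j s t. j \<in> J \<Longrightarrow> s \<in> {a..b} \<Longrightarrow> t \<in> {a..b} \<Longrightarrow> c s \<in> E j \<Longrightarrow> c t \<in> E j \<Longrightarrow> \<bar>\<psi> s - \<psi> t\<bar> \<le> osc j"
    and cover: "\<And>t. t \<in> {a..b} \<Longrightarrow> \<exists>j\<in>J. c t \<in> E j"
  shows "1 \<le> (\<Sum>j\<in>{j\<in>J. \<exists>t\<in>{a..b}. c t \<in> E j}. 2 * osc j)"
proof -
  define J' where "J' = {j\<in>J. \<exists>t\<in>{a..b}. c t \<in> E j}"
  have fin: "finite J'" using assms(5) by (simp add: J'_def)
  have "\<exists>t. \<forall>j\<in>J'. t j \<in> {a..b} \<and> c (t j) \<in> E j" by (rule bchoice) (auto simp: J'_def)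
  then obtain t where t: "\<And>j. j \<in> J' \<Longrightarrow> t j \<in> {a..b}" "\<And>j. j \<in> J' \<Longrightarrow> c (t j) \<in> E j" by blast
  have nn: "osc j \<ge> 0" if "j \<in> J'" for j
    using osc[of j "t j" "t j"] t that by (auto simp: J'_def)
  have sub: "{0..1} \<subseteq> (\<Union>j\<in>J'. cball (\<psi> (t j)) (osc j))"
  proof
    fix v :: real assume v: "v \<in> {0..1}"
    then obtain s where s: "s \<in> {a..b}" "\<psi> s = v"
      using IVT'[of \<psi> a v b] assms by auto
    then obtain j where j: "j \<in> J" "c s \<in> E j" using cover by blast
    then have "j \<in> J'" using s(1) by (auto simp: J'_def)
    then have "\<bar>\<psi> (t j) - \<psi> s\<bar> \<le> osc j" using osc j s t by blast
    then show "v \<in> (\<Union>j\<in>J'. cball (\<psi> (t j)) (osc j))"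
      using \<open>j \<in> J'\<close> s(2) by (auto simp: dist_real_def)
  qed
  have "1 = measure lborel {0..1::real}" by simp
  also have "\<dots> \<le> measure lborel (\<Union>j\<in>J'. cball (\<psi> (t j)) (osc j))"
    using fin by (intro measure_mono_fmeasurable[OF sub] fmeasurable.finite_UN)
      (auto intro!: fmeasurableI emeasure_lborel_cball_finite)
  also have "\<dots> \<le> (\<Sum>j\<in>J'. measure lborel (cball (\<psi> (t j)) (osc j)))"
    using fin by (intro measure_UNION_le) auto
  also have "\<dots> = (\<Sum>j\<in>J'. 2 * osc j)"
    by (intro sum.cong refl) (use nn in \<open>auto simp: cball_eq_atLeastAtMost\<close>)
  finally show ?thesis by (simp add: J'_def)
qed

text \<open>The set of parameters \<open>w\<close> whose segment meets \<open>E\<close> lies in the \<open>d\<close>-neighbourhood of a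
  segment of length at most 2, which is covered by \<open>O(1/d)\<close> balls of radius \<open>2 * d\<close>.\<close>

lemma tube_measure:
  fixes z u :: "real ^ 'n::finite" and E :: "'n torus set"
  assumes u: "norm u = 1" and k: "0 < k" "k \<le> 1/32" and d: "0 < d" "d \<le> 1"
    and diam: "\<And>x y. x \<in> E \<Longrightarrow> y \<in> E \<Longrightarrow> dist x y \<le> d"
  obtains H where "H \<in> sets lborel"
    "{w \<in> ball 0 (k/2). \<exists>t\<in>{-k..k}. torus_proj (z + w + t *\<^sub>R u) \<in> E} \<subseteq> H"
    "emeasure lborel H \<le> ennreal (5 * 2 ^ CARD('n) * unit_ball_vol CARD('n) * d ^ (CARD('n) - 1))"
proof (cases "{w \<in> ball 0 (k/2). \<exists>t\<in>{-k..k}. torus_proj (z + w + t *\<^sub>R u) \<in> E} = {}")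
  case True
  then show ?thesis by (intro that[of "{}"]) auto
next
  case False
  then obtain w0 t0 where w0: "w0 \<in> ball 0 (k/2)" "t0 \<in> {-k..k}" "torus_proj (z + w0 + t0 *\<^sub>R u) \<in> E" by blast
  \<comment> \<open>The shift \<open>s\<close> along \<open>u\<close> is at most 1/16 in absolute
    value, so steps of length \<open>d\<close> with index up to \<open>1/d\<close> reach it.\<close>
  define N :: int where "N = \<lceil>1/d\<rceil>"
  define H where "H = (\<Union>j\<in>{-N..N}. cball (w0 + (of_int j * d) *\<^sub>R u) (2 * d))"
  have "w \<in> H" if w: "w \<in> ball 0 (k/2)" "t \<in> {-k..k}" "torus_proj (z + w + t *\<^sub>R u) \<in> E" for w t
  proof -
    define s where "s = t0 - t"
    have "\<bar>s\<bar> \<le> 2 * k" using w(2) w0(2) by (auto simp: s_def)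
    then have s: "\<bar>s\<bar> \<le> 1/16" using k(2) by simp
    have eq: "dist (z + w + t *\<^sub>R u) (z + w0 + t0 *\<^sub>R u) = norm (w - w0 - s *\<^sub>R u)"
      by (simp add: dist_norm s_def algebra_simps)
    also have "\<dots> \<le> norm w + norm w0 + \<bar>s\<bar>"
      using norm_triangle_ineq4[of "w - w0" "s *\<^sub>R u"] norm_triangle_ineq4[of w w0] u by simp
    finally have "dist (z + w + t *\<^sub>R u) (z + w0 + t0 *\<^sub>R u) \<le> 1/2" using w w0 s k by simp
    then have n: "norm (w - w0 - s *\<^sub>R u) \<le> d"
      using dist_torus_proj_eq[of "z + w + t *\<^sub>R u" "z + w0 + t0 *\<^sub>R u"] diam[OF w(3) w0(3)] eq by simp
    define j where "j = \<lfloor>s / d\<rfloor>"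
    have "of_int j \<le> s / d" "s / d \<le> of_int j + 1" unfolding j_def by linarith+
    then have j: "of_int j * d \<le> s" "s \<le> of_int j * d + d"
      using d(1) by (simp_all add: pos_le_divide_eq pos_divide_le_eq distrib_right)
    have "\<bar>s / d\<bar> \<le> 1 / d" using s d(1) by (simp add: divide_right_mono)
    then have "- (1/d) \<le> s / d" "s / d \<le> 1 / d" by linarith+
    moreover have "1 / d \<le> of_int N" unfolding N_def by (rule le_of_int_ceiling)
    ultimately have "of_int j \<le> (of_int N :: real)" "of_int (- N) \<le> s / d"
      using \<open>of_int j \<le> s / d\<close> by simp_all
    then have "j \<in> {-N..N}" unfolding j_def by (simp add: le_floor_iff)
    moreover have "dist (w0 + (of_int j * d) *\<^sub>R u) w \<le> 2 * d"
    proof -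
      have eq': "w - (w0 + (of_int j * d) *\<^sub>R u) = (w - w0 - s *\<^sub>R u) + (s - of_int j * d) *\<^sub>R u"
        by (simp add: algebra_simps)
      have "norm (w - (w0 + (of_int j * d) *\<^sub>R u)) \<le> d + \<bar>s - of_int j * d\<bar>"
        unfolding eq' using norm_triangle_ineq[of "w - w0 - s *\<^sub>R u" "(s - of_int j * d) *\<^sub>R u"] n u by simp
      then show ?thesis using j by (simp add: dist_norm norm_minus_commute)
    qed
    ultimately show ?thesis unfolding H_def by auto
  qed
  then have sub: "{w \<in> ball 0 (k/2). \<exists>t\<in>{-k..k}. torus_proj (z + w + t *\<^sub>R u) \<in> E} \<subseteq> H" by blast
  have "1/d > 0" using d(1) by simp
  then have N: "N \<ge> 0" "of_int N \<le> 1/d + 1" unfolding N_def by linarith+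
  have "emeasure lborel H \<le> (\<Sum>j\<in>{-N..N}. emeasure lborel (cball (w0 + (of_int j * d) *\<^sub>R u) (2 * d)))"
    unfolding H_def by (intro emeasure_subadditive_finite) auto
  also have "\<dots> = (\<Sum>j\<in>{-N..N}. ennreal (unit_ball_vol CARD('n) * (2 * d) ^ CARD('n)))"
    using d(1) by (simp add: emeasure_cball)
  also have "\<dots> = ennreal (real (card {-N..N}) * (unit_ball_vol CARD('n) * (2 * d) ^ CARD('n)))"
    by (simp add: ennreal_mult' ennreal_of_nat_eq_real_of_nat)
  also have "\<dots> \<le> ennreal (5 / d * (unit_ball_vol CARD('n) * (2 * d) ^ CARD('n)))"
  proof (intro ennreal_leI mult_right_mono)
    have "real (card {-N..N}) = 2 * of_int N + 1" using N(1) by simp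
    also have "\<dots> \<le> 2 / d + 3" using N(2) by simp
    also have "\<dots> \<le> 5 / d" using d by (simp add: field_simps)
    finally show "real (card {-N..N}) \<le> 5 / d" .
  qed (use d in simp)
  also have "5 / d * (unit_ball_vol CARD('n) * (2 * d) ^ CARD('n))
      = 5 * 2 ^ CARD('n) * unit_ball_vol CARD('n) * d ^ (CARD('n) - 1)"
  proof -
    obtain m where "CARD('n) = Suc m" using not0_implies_Suc zero_less_card_finite by (metis less_numeral_extra(3))
    then show ?thesis using d(1) by (simp add: power_mult_distrib)
  qed
  finally show ?thesis using sub by (intro that[of H]) (auto simp: H_def)
qed

text \<open>Integrates \<open>osc_sum_ge_1\<close> over the parallel segments: \<open>j\<close>
  counts only for parameters whose segment meets \<open>E j\<close>, a set of volume
  O(\<open>d j ^ (CARD('n) - 1)\<close>) by \<open>tube_measure\<close>. The unit ball volume occurs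
  on both sides and cancels.\<close>

lemma crossing_estimate:
  fixes z u :: "real ^ 'n::finite" and E :: "'j \<Rightarrow> 'n torus set" and \<psi> :: "'n torus \<Rightarrow> real"
  assumes u: "norm u = 1" and k: "0 < k" "k \<le> 1/32" and J: "finite J"
    and d: "\<And>j. j \<in> J \<Longrightarrow> 0 < d j" "\<And>j. j \<in> J \<Longrightarrow> d j \<le> 1"
    and diam: "\<And>j x y. j \<in> J \<Longrightarrow> x \<in> E j \<Longrightarrow> y \<in> E j \<Longrightarrow> dist x y \<le> d j"
    and osc: "\<And>j x y. j \<in> J \<Longrightarrow> x \<in> E j \<Longrightarrow> y \<in> E j \<Longrightarrow> \<bar>\<psi> x - \<psi> y\<bar> \<le> osc j"
    and osc_nonneg: "\<And>j. j \<in> J \<Longrightarrow> osc j \<ge> 0"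
    and cont: "continuous_on UNIV \<psi>"
    and ends: "\<And>w. w \<in> ball 0 (k/2) \<Longrightarrow> \<psi> (torus_proj (z + w + (- k) *\<^sub>R u)) = 0"
      "\<And>w. w \<in> ball 0 (k/2) \<Longrightarrow> \<psi> (torus_proj (z + w + k *\<^sub>R u)) = 1"
    and cover: "\<And>w t. w \<in> ball 0 (k/2) \<Longrightarrow> t \<in> {-k..k} \<Longrightarrow> \<exists>j\<in>J. torus_proj (z + w + t *\<^sub>R u) \<in> E j"
  shows "(k/2) ^ CARD('n) \<le> 10 * 2 ^ CARD('n) * (\<Sum>j\<in>J. osc j * d j ^ (CARD('n) - 1))"
proof -
  define V where "V = unit_ball_vol CARD('n)"
  have V: "V > 0" by (simp add: V_def)
  define G where "G = (\<lambda>j. {w \<in> ball 0 (k/2). \<exists>t\<in>{-k..k}. torus_proj (z + w + t *\<^sub>R u) \<in> E j})"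
  \<comment> \<open>\<open>E j\<close> is arbitrary and \<open>G j\<close> need not be measurable,
    so a Borel set containing it is integrated instead.\<close>
  have "\<exists>H. H \<in> sets lborel \<and> G j \<subseteq> H \<and>
      emeasure lborel H \<le> ennreal (5 * 2 ^ CARD('n) * V * d j ^ (CARD('n) - 1))" if "j \<in> J" for j
    unfolding G_def V_def
    by (rule tube_measure[OF u k d(1)[OF that] d(2)[OF that] diam[OF that], where z = z]) blast+
  then obtain H where H: "\<And>j. j \<in> J \<Longrightarrow> H j \<in> sets lborel" "\<And>j. j \<in> J \<Longrightarrow> G j \<subseteq> H j"
      "\<And>j. j \<in> J \<Longrightarrow> emeasure lborel (H j) \<le> ennreal (5 * 2 ^ CARD('n) * V * d j ^ (CARD('n) - 1))"
    by metis
  have pt: "indicator (ball 0 (k/2)) w \<le> (\<Sum>j\<in>J. ennreal (2 * osc j) * indicator (H j) w)" for w :: "real ^ 'n"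
  proof (cases "w \<in> ball 0 (k/2)")
    case w: True
    define c where "c = (\<lambda>t. torus_proj (z + w + t *\<^sub>R u))"
    have "continuous_on {-k..k} c"
      unfolding c_def by (intro continuous_on_compose2[OF continuous_on_torus_proj[of UNIV]] continuous_intros) auto
    then have "continuous_on {-k..k} (\<lambda>t. \<psi> (c t))" by (intro continuous_on_compose2[OF cont]) auto
    then have "1 \<le> (\<Sum>j\<in>{j\<in>J. \<exists>t\<in>{-k..k}. c t \<in> E j}. 2 * osc j)"
      using k J ends[OF w] osc cover[OF w] by (intro osc_sum_ge_1[where \<psi> = "\<lambda>t. \<psi> (c t)" and c = c]) (auto simp: c_def)
    also have "\<dots> \<le> (\<Sum>j\<in>J. 2 * osc j * indicator (H j) w)"
      unfolding sum.inter_filter[OF J]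
    proof (rule sum_mono)
      fix j assume j: "j \<in> J"
      show "(if \<exists>t\<in>{-k..k}. c t \<in> E j then 2 * osc j else 0) \<le> 2 * osc j * indicator (H j) w"
        using H(2)[OF j] w osc_nonneg[OF j] by (auto simp: G_def c_def indicator_def)
    qed
    finally have "ennreal 1 \<le> ennreal (\<Sum>j\<in>J. 2 * osc j * indicator (H j) w)" by (rule ennreal_leI)
    also have "\<dots> = (\<Sum>j\<in>J. ennreal (2 * osc j * indicator (H j) w))"
      using osc_nonneg by (intro sum_ennreal[symmetric]) auto
    also have "\<dots> = (\<Sum>j\<in>J. ennreal (2 * osc j) * indicator (H j) w)"
      by (intro sum.cong refl) (auto simp: indicator_def)
    finally show ?thesis using w by simp
  qed simp
  have "ennreal (V * (k/2) ^ CARD('n)) = emeasure lborel (ball (0 :: real ^ 'n) (k/2))"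
    using k by (simp add: emeasure_ball V_def)
  also have "\<dots> = (\<integral>\<^sup>+w. indicator (ball (0 :: real ^ 'n) (k/2)) w \<partial>lborel)" by simp
  also have "\<dots> \<le> (\<integral>\<^sup>+w. (\<Sum>j\<in>J. ennreal (2 * osc j) * indicator (H j) w) \<partial>lborel)"
    by (intro nn_integral_mono pt)
  also have "\<dots> = (\<Sum>j\<in>J. ennreal (2 * osc j) * emeasure lborel (H j))"
    using H(1) by (subst nn_integral_sum) (auto intro!: sum.cong nn_integral_cmult_indicator)
  also have "\<dots> \<le> (\<Sum>j\<in>J. ennreal (2 * osc j) * ennreal (5 * 2 ^ CARD('n) * V * d j ^ (CARD('n) - 1)))"
    by (intro sum_mono mult_left_mono H(3)) auto
  also have "\<dots> = (\<Sum>j\<in>J. ennreal (V * (10 * 2 ^ CARD('n) * (osc j * d j ^ (CARD('n) - 1)))))"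
    using osc_nonneg d(1) V
    by (intro sum.cong refl) (simp add: ennreal_mult[symmetric] less_imp_le mult_ac)
  also have "\<dots> = ennreal (\<Sum>j\<in>J. V * (10 * 2 ^ CARD('n) * (osc j * d j ^ (CARD('n) - 1))))"
    using osc_nonneg d(1) V by (intro sum_ennreal) (simp add: less_imp_le)
  also have "\<dots> = ennreal (V * (10 * 2 ^ CARD('n) * (\<Sum>j\<in>J. osc j * d j ^ (CARD('n) - 1))))"
    by (simp add: sum_distrib_left)
  finally have "V * (k/2) ^ CARD('n) \<le> V * (10 * 2 ^ CARD('n) * (\<Sum>j\<in>J. osc j * d j ^ (CARD('n) - 1)))"
    using V osc_nonneg d(1)
    by (subst (asm) ennreal_le_iff) (auto intro!: mult_nonneg_nonneg sum_nonneg simp: less_imp_le)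
  then show ?thesis using V by simp
qed

text \<open>A weighted Young inequality, by cases on whether \<open>x\<close> or
  \<open>M * y\<close> is larger. The second case uses \<open>M ^ (k - 1) \<ge> M\<close>, where
  \<open>k \<ge> 2\<close> enters.\<close>

lemma mult_power_le_weighted_sum:
  fixes M x y :: real
  assumes "M \<ge> 1" "x \<ge> 0" "y \<ge> 0" "k \<ge> 2"
  shows "x * y ^ (k - 1) \<le> M * y ^ k + x ^ k / M"
proof -
  obtain m where m: "k = Suc m" "m \<ge> 1" using assms(4) by (cases k) auto
  show ?thesis
  proof (cases "x \<le> M * y")
    case True
    then have "x * y ^ m \<le> M * y * y ^ m" using assms by (intro mult_right_mono) auto
    then show ?thesis using assms m by (simp add: mult_ac add_increasing2)
  next
    case False
    then have "y \<le> x / M" using assms(1) by (simp add: field_simps)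
    then have "y ^ m \<le> (x / M) ^ m" using assms(3) by (rule power_mono)
    also have "\<dots> \<le> x ^ m / M"
      using assms m self_le_power[of M m] by (simp add: power_divide frac_le)
    finally have "x * y ^ m \<le> x * (x ^ m / M)" using assms(2) by (rule mult_left_mono)
    then show ?thesis using assms m by (simp add: add_increasing)
  qed
qed

section \<open>Collapsing a fibre\<close>

context round_fibres
begin

text \<open>The fibre over \<open>p0\<close> is removed because it has positive volume. The cutoff
  vanishes on it, so it never has to be paid for.\<close>

definition punctured :: "real ^ 'n \<Rightarrow> real \<Rightarrow> (real ^ 'n) set" where
  "punctured z t = {x \<in> ball z (1/4). \<phi> (torus_proj x) \<in> ball p0 t - {p0}}"

lemma continuous_phi_proj: "continuous_on UNIV (\<lambda>x. \<phi> (torus_proj x))"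
  by (intro continuous_on_compose2[OF cont_phi continuous_on_torus_proj]) auto

lemma punctured_fmeasurable: "punctured z t \<in> fmeasurable lborel"
proof -
  have "open ((\<lambda>x. \<phi> (torus_proj x)) -` (ball p0 t - {p0}))"
    using continuous_phi_proj by (intro open_vimage) auto
  then have "open (ball z (1/4) \<inter> (\<lambda>x. \<phi> (torus_proj x)) -` (ball p0 t - {p0}))" by blast
  moreover have "punctured z t = ball z (1/4) \<inter> (\<lambda>x. \<phi> (torus_proj x)) -` (ball p0 t - {p0})"
    by (auto simp: punctured_def)
  ultimately have "punctured z t \<in> sets lborel" by simp
  moreover have "punctured z t \<subseteq> ball z (1/4)" by (auto simp: punctured_def)
  moreover have "ball z (1/4) \<in> fmeasurable lborel"
    by (intro fmeasurableI emeasure_lborel_ball_finite) auto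
  ultimately show ?thesis using fmeasurableI2 by blast
qed

text \<open>The sets decrease to the empty set as the radius tends to 0, and their measures are
  finite.\<close>

lemma punctured_small:
  assumes "e > 0"
  obtains t where "t > 0" "\<And>t'. t' \<le> t \<Longrightarrow> measure lborel (punctured z t') < e"
proof -
  define A where "A = (\<lambda>i. punctured z (1 / Suc i))"
  have "decseq A"
    unfolding decseq_def A_def punctured_def
    by (auto simp: frac_le elim!: less_le_trans)
  moreover have "(\<Inter>i. A i) = {}"
  proof (rule ccontr)
    assume "(\<Inter>i. A i) \<noteq> {}"
    then obtain x where x: "\<And>i. x \<in> A i" by blast
    have "dist p0 (\<phi> (torus_proj x)) > 0" using x[of 0] by (auto simp: A_def punctured_def)
    then obtain i where "1 / Suc i < dist p0 (\<phi> (torus_proj x))"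
      using nat_approx_posE by blast
    then show False using x[of i] by (auto simp: A_def punctured_def)
  qed
  ultimately have "(\<lambda>i. measure lborel (A i)) \<longlonglongrightarrow> 0"
    using Lim_measure_decseq[of A lborel] punctured_fmeasurable
    by (auto simp: A_def fmeasurable_def less_top)
  from order_tendstoD(2)[OF this assms] obtain i where i: "measure lborel (A i) < e"
    unfolding eventually_sequentially by blast
  show ?thesis
  proof (rule that[of "1 / Suc i"])
    fix t' assume "t' \<le> 1 / real (Suc i)"
    then have "punctured z t' \<subseteq> A i" by (auto simp: A_def punctured_def)
    then show "measure lborel (punctured z t') < e"
      using measure_mono_fmeasurable[of "punctured z t'" "A i" lborel] punctured_fmeasurable i
      by (auto simp: A_def fmeasurable_def)
  qed simp
qed

lemma dist_T_funpow: "dist ((T ^^ n) x) ((T ^^ n) y) = dist x y"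
  by (induction n) (auto simp: dist_torus_add_right)

lemma phi_funpow: "\<phi> ((f ^^ n) x) = (T ^^ n) (\<phi> x)"
  by (induction n) (auto simp: semiconj)

lemma ball_fibre_shift_funpow: "euclidean_ball (fibre ((T ^^ n) q)) \<longleftrightarrow> euclidean_ball (fibre q)"
  by (induction n) (auto simp: ball_fibre_shift)

lemma continuous_funpow: "continuous_on UNIV (f ^^ n)"
proof (induction n)
  case (Suc n)
  then show ?case using continuous_on_compose[of UNIV "f ^^ n" f] cont_f
    by (auto intro: continuous_on_subset)
qed (simp add: id_def)

lemma funpow_uniformly_expansive:
  assumes "e > 0"
  obtains d where "d > 0" "\<And>x y. dist ((f ^^ n) x) ((f ^^ n) y) < d \<Longrightarrow> dist x y < e"
proof -
  have "continuous_on UNIV (inv f ^^ n)"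
  proof (induction n)
    case (Suc n)
    then show ?case using continuous_on_compose[of UNIV "inv f ^^ n" "inv f"] cont_inv_f
      by (auto intro: continuous_on_subset)
  qed (simp add: id_def)
  then have "uniformly_continuous_on UNIV (inv f ^^ n)"
    using compact_uniformly_continuous compact_torus by blast
  then obtain d where d: "d > 0" "\<And>x y. dist y x < d \<Longrightarrow> dist ((inv f ^^ n) y) ((inv f ^^ n) x) < e"
    using assms unfolding uniformly_continuous_on_def by (metis UNIV_I)
  have inv: "(inv f ^^ n) ((f ^^ n) x) = x" for x
  proof (induction n)
    case (Suc n)
    have "(inv f ^^ Suc n) y = (inv f ^^ n) (inv f y)" for y by (simp only: funpow_Suc_right comp_apply)
    then show ?case using Suc by (metis funpow.simps(2) comp_apply inv_f_f)
  qed simp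
  show ?thesis
    by (rule that[of d]) (use d inv in metis)+
qed

end

text \<open>The function \<open>cutoff\<close> vanishes on the fibre over \<open>p0\<close>, which the iterate maps to a ball of
  radius less than \<open>s\<close>, and equals 1 outside a thin neighbourhood of that fibre.\<close>

locale collapse = round_fibres f \<phi> \<theta> p0
  for f \<phi> :: "'n::finite torus \<Rightarrow> 'n torus" and \<theta> p0 :: "'n torus" +
  fixes z c :: "real ^ 'n" and n :: nat and \<rho> s t :: real
  assumes fibre_n: "fibre ((T ^^ n) p0) = torus_proj ` cball c \<rho>"
    and rho: "0 < \<rho>" "\<rho> < s" and s: "s \<le> 1/32"
    and phi_close: "dist x y < 3 * s \<Longrightarrow> dist (\<phi> x) (\<phi> y) < t"
    and thin: "q \<noteq> p0 \<Longrightarrow> dist q p0 < t \<Longrightarrow> \<not> ball x (1/32) \<subseteq> fibre q"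
begin

abbreviation g :: "'n torus \<Rightarrow> 'n torus" where "g \<equiv> f ^^ n"

abbreviation y0 :: "'n torus" where "y0 \<equiv> torus_proj c"

definition cutoff :: "'n torus \<Rightarrow> real" where
  "cutoff x = max 0 (min 1 (dist (g x) y0 / s - 1))"

section \<open>Elementary properties of the cutoff\<close>

lemma s_pos: "s > 0" using rho by simp

lemma cutoff_bounds: "0 \<le> cutoff x" "cutoff x \<le> 1" by (auto simp: cutoff_def)

lemma cutoff_less_1:
  assumes "cutoff x < 1" shows "dist (g x) y0 < 2 * s"
proof -
  have "dist (g x) y0 / s < 2" using assms unfolding cutoff_def by linarith
  then show ?thesis using s_pos by (simp add: pos_divide_less_eq)
qed

lemma cutoff_pos:
  assumes "cutoff x > 0" shows "dist (g x) y0 > s"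
proof -
  have "1 < dist (g x) y0 / s" using assms unfolding cutoff_def by linarith
  then show ?thesis using s_pos by (simp add: pos_less_divide_eq)
qed

lemma cutoff_neq_cases:
  assumes "cutoff x \<noteq> cutoff y"
  obtains "cutoff x < 1" "cutoff y > 0" | "cutoff y < 1" "cutoff x > 0"
  using assms cutoff_bounds[of x] cutoff_bounds[of y] by linarith

lemma cutoff_lipschitz: "\<bar>cutoff x - cutoff y\<bar> \<le> dist (g x) (g y) / s"
proof -
  have "\<bar>cutoff x - cutoff y\<bar> \<le> \<bar>dist (g x) y0 / s - dist (g y) y0 / s\<bar>"
    unfolding cutoff_def by linarith
  also have "\<dots> = \<bar>dist (g x) y0 - dist (g y) y0\<bar> / s"
    using s_pos by (simp add: diff_divide_distrib[symmetric])
  also have "\<dots> \<le> dist (g x) (g y) / s"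
    using s_pos abs_dist_diff_le[of "g x" y0 "g y"] by (intro divide_right_mono) (auto simp: dist_commute)
  finally show ?thesis .
qed

lemma continuous_cutoff: "continuous_on UNIV cutoff"
  unfolding cutoff_def using s_pos by (intro continuous_intros continuous_funpow) auto

lemma phi_y0: "\<phi> y0 = (T ^^ n) p0"
  using fibre_n rho by (metis centre_in_cball image_eqI less_imp_le vimage_singleton_eq)

text \<open>\<open>y0\<close> lies over the \<open>n\<close>-th translate of \<open>p0\<close>, and
  translations are isometries. Hence closeness under \<open>g\<close> gives closeness of
  \<open>\<phi> x\<close> to \<open>p0\<close> with a \<open>t\<close> that does not depend on
  \<open>n\<close>.\<close>

lemma near_phi: "dist (g x) y0 < 3 * s \<Longrightarrow> dist (\<phi> x) p0 < t"
  using phi_close[of "g x" y0] by (simp add: phi_y0 phi_funpow dist_T_funpow)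

lemma far_phi:
  assumes "dist (g x) y0 > \<rho>" shows "\<phi> x \<noteq> p0"
proof
  assume "\<phi> x = p0"
  then have "g x \<in> fibre ((T ^^ n) p0)" by (simp add: phi_funpow)
  then obtain v where "v \<in> cball c \<rho>" "g x = torus_proj v" using fibre_n by auto
  then show False using dist_torus_proj_le[of v c] assms by (simp add: dist_commute)
qed

lemma cutoff_eq_0: "\<phi> x = p0 \<Longrightarrow> cutoff x = 0"
  using far_phi[of x] cutoff_pos[of x] cutoff_bounds[of x] rho by force

lemma cutoff_eq_1: "dist (\<phi> x) p0 \<ge> t \<Longrightarrow> cutoff x = 1"
  using near_phi[of x] cutoff_less_1[of x] cutoff_bounds[of x] s_pos by force

text \<open>Only fibres in \<open>A\<close>, where the cutoff is not constant, contribute. Their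
  images contain disjoint balls of radius \<open>h q\<close> inside a ball of radius
  \<open>4 * s\<close>, which gives \<open>(2 / s * 4 * s) ^ CARD('n)\<close>; they themselves
  contain disjoint balls inside the punctured neighbourhood.\<close>

lemma fibre_part:
  assumes Q: "finite Q" "\<And>q. q \<in> Q \<Longrightarrow> euclidean_ball (fibre q)"
    "\<And>q. q \<in> Q \<Longrightarrow> fibre q \<inter> ball (torus_proj z) (1/16) \<noteq> {}"
  obtains osc d where
    "\<And>q. q \<in> Q \<Longrightarrow> osc q \<ge> 0" "\<And>q. q \<in> Q \<Longrightarrow> 0 < d q" "\<And>q. q \<in> Q \<Longrightarrow> d q \<le> 1"
    "\<And>q x y. q \<in> Q \<Longrightarrow> x \<in> fibre q \<Longrightarrow> y \<in> fibre q \<Longrightarrow> dist x y \<le> d q"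
    "\<And>q x y. q \<in> Q \<Longrightarrow> x \<in> fibre q \<Longrightarrow> y \<in> fibre q \<Longrightarrow> \<bar>cutoff x - cutoff y\<bar> \<le> osc q"
    "(\<Sum>q\<in>Q. osc q ^ CARD('n)) \<le> 8 ^ CARD('n)"
    "(\<Sum>q\<in>{q\<in>Q. osc q \<noteq> 0}. d q ^ CARD('n)) * unit_ball_vol CARD('n)
       \<le> 2 ^ CARD('n) * measure lborel (punctured z t)"
proof -
  let ?k = "CARD('n)"
  have k: "?k > 0" by simp
  have vol: "unit_ball_vol ?k > 0" by simp
  have "\<exists>C r. 0 < r \<and> r < 1/2 \<and> ball C r \<subseteq> fibre q \<and> fibre q \<subseteq> cball C r" if q: "q \<in> Q" for q
    using Q(2)[OF q] by (rule euclidean_ballE) blast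
  then obtain C r where r: "\<And>q. q \<in> Q \<Longrightarrow> 0 < r q" "\<And>q. q \<in> Q \<Longrightarrow> r q < 1/2"
    and C: "\<And>q. q \<in> Q \<Longrightarrow> ball (C q) (r q) \<subseteq> fibre q" "\<And>q. q \<in> Q \<Longrightarrow> fibre q \<subseteq> cball (C q) (r q)"
    by metis
  have "\<exists>C' r'. 0 < r' \<and> fibre ((T ^^ n) q) = torus_proj ` cball C' r'" if q: "q \<in> Q" for q
    using iffD2[OF ball_fibre_shift_funpow[of n q] Q(2)[OF q]] by (rule euclidean_ballE) blast
  then obtain C' r' where r': "\<And>q. q \<in> Q \<Longrightarrow> 0 < r' q"
    and C': "\<And>q. q \<in> Q \<Longrightarrow> fibre ((T ^^ n) q) = torus_proj ` cball (C' q) (r' q)"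
    by metis
  define A where "A = {q\<in>Q. \<exists>x\<in>fibre q. \<exists>y\<in>fibre q. cutoff x \<noteq> cutoff y}"
  have AQ: "A \<subseteq> Q" "finite A" using Q(1) by (auto simp: A_def)
  \<comment> \<open>An image ball may be much larger than \<open>s\<close>. The oscillation is
    bounded anyway, so the radius is truncated at \<open>s\<close>.\<close>
  define h where "h = (\<lambda>q. min (r' q) s)"
  have h: "0 < h q" "h q \<le> r' q" "h q \<le> s" if "q \<in> Q" for q
    using r'[OF that] s_pos by (auto simp: h_def)
  define osc where "osc = (\<lambda>q. if q \<in> A then 2 * h q / s else 0)"
  have low: "\<exists>x\<in>fibre q. dist (g x) y0 < 2 * s" if "q \<in> A" for q
    using that cutoff_less_1 cutoff_neq_cases unfolding A_def by blast
  have A_near: "q \<noteq> p0" "dist q p0 < t" if q: "q \<in> A" for q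
  proof -
    show "q \<noteq> p0" using q cutoff_eq_0 by (auto simp: A_def)
    obtain x where "x \<in> fibre q" "dist (g x) y0 < 2 * s" using low[OF q] by blast
    then show "dist q p0 < t" using near_phi[of x] s_pos by auto
  qed
  have rA: "r q < 1/32" if "q \<in> A" for q
    using thin[OF A_near[OF that], of "C q"] C(1)[of q] AQ that subset_ball[of "1/32" "r q" "C q"]
    by (meson not_le order_trans subsetD)
  \<comment> \<open>The sum \<open>4 * s\<close> consists of \<open>2 * s\<close> for a point where
    the cutoff is below 1, and twice \<open>h q \<le> s\<close> for the inscribed ball.\<close>
  have hole: "\<exists>x. ball x (h q) \<subseteq> fibre ((T ^^ n) q) \<and> dist y0 x + h q \<le> 4 * s" if q: "q \<in> A" for q
  proof -
    obtain x where x: "x \<in> fibre q" "dist (g x) y0 < 2 * s" using low[OF q] by blast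
    have qQ: "q \<in> Q" using AQ q by blast
    have "g x \<in> torus_proj ` cball (C' q) (r' q)" using C'[OF qQ] x(1) by (auto simp: phi_funpow)
    then obtain y where y: "ball y (h q) \<subseteq> torus_proj ` cball (C' q) (r' q)" "dist y (g x) \<le> h q"
      using torus_proj_cball_subball h[OF qQ] by metis
    have "dist y0 y + h q \<le> 4 * s"
      using x(2) y(2) h(3)[OF qQ] dist_triangle[of y0 y "g x"] by (simp add: dist_commute)
    then show ?thesis using y(1) C'[OF qQ] by blast
  qed
  then obtain b where b: "\<And>q. q \<in> A \<Longrightarrow> ball (b q) (h q) \<subseteq> fibre ((T ^^ n) q)"
     "\<And>q. q \<in> A \<Longrightarrow> dist y0 (b q) + h q \<le> 4 * s" by metis
  show ?thesis
  proof (rule that[of osc "\<lambda>q. 2 * r q"])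
    fix q assume q: "q \<in> Q"
    show "osc q \<ge> 0" using h[OF q] s_pos by (simp add: osc_def)
    show "0 < 2 * r q" "2 * r q \<le> 1" using r(1)[OF q] r(2)[OF q] by simp_all
    fix x y assume xy: "x \<in> fibre q" "y \<in> fibre q"
    show "dist x y \<le> 2 * r q"
      using subsetD[OF C(2)[OF q] xy(1)] subsetD[OF C(2)[OF q] xy(2)] dist_triangle2[of x y "C q"]
      by (simp add: dist_commute)
    show "\<bar>cutoff x - cutoff y\<bar> \<le> osc q"
    proof (cases "q \<in> A")
      case True
      have "g x \<in> torus_proj ` cball (C' q) (r' q)" "g y \<in> torus_proj ` cball (C' q) (r' q)"
        using C'[OF q] xy by (auto simp: phi_funpow)
      then obtain u v where "g x = torus_proj u" "u \<in> cball (C' q) (r' q)"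
         "g y = torus_proj v" "v \<in> cball (C' q) (r' q)" by blast
      then have "dist (g x) (g y) \<le> 2 * r' q"
        using dist_torus_proj_le[of u v] dist_triangle2[of u v "C' q"] by (simp add: dist_commute)
      then have "dist (g x) (g y) / s \<le> 2 * r' q / s" using s_pos by (simp add: divide_right_mono)
      then have "\<bar>cutoff x - cutoff y\<bar> \<le> 2 * r' q / s" using cutoff_lipschitz order_trans by blast
      moreover have "\<bar>cutoff x - cutoff y\<bar> \<le> 2"
        using cutoff_bounds[of x] cutoff_bounds[of y] by linarith
      ultimately show ?thesis using True s_pos by (auto simp: osc_def h_def min_def)
    next
      case False
      then have "cutoff x = cutoff y" using xy q unfolding A_def by blast
      then show ?thesis using False by (simp add: osc_def)
    qed
  next
    have "(\<Sum>q\<in>A. h q ^ ?k) * unit_ball_vol ?k \<le> measure lborel (ball c (4 * s))"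
    proof (rule torus_packing[where a = c and x = b])
      show "ball (b i) (h i) \<inter> ball (b j) (h j) = {}" if "i \<in> A" "j \<in> A" "i \<noteq> j" for i j
      proof -
        have "(T ^^ n) i \<noteq> (T ^^ n) j" using dist_T_funpow[of n i j] that(3) by auto
        then have "fibre ((T ^^ n) i) \<inter> fibre ((T ^^ n) j) = {}" by auto
        then show ?thesis using Int_mono[OF b(1)[OF that(1)] b(1)[OF that(2)]] by simp
      qed
      show "dist y0 (b i) + h i < 1/4" if "i \<in> A" for i using b(2)[OF that] s by simp
      show "x \<in> ball c (4 * s)" if i: "i \<in> A" "x \<in> ball c (1/4)" "torus_proj x \<in> ball (b i) (h i)" for i x
        using dist_torus_proj_eq[of c x] dist_triangle[of y0 "torus_proj x" "b i"] b(2)[OF i(1)] i(2,3)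
        by (simp add: dist_commute)
    qed (use AQ h in \<open>auto intro!: fmeasurableI emeasure_lborel_ball_finite\<close>)
    also have "\<dots> = (4 * s) ^ ?k * unit_ball_vol ?k" using s_pos by (simp add: content_ball mult.commute)
    finally have hs: "(\<Sum>q\<in>A. h q ^ ?k) \<le> (4 * s) ^ ?k" using vol by simp
    have "(\<Sum>q\<in>Q. osc q ^ ?k) = (\<Sum>q\<in>A. osc q ^ ?k)"
      using Q(1) AQ k by (intro sum.mono_neutral_right) (auto simp: osc_def)
    also have "\<dots> = (\<Sum>q\<in>A. (2 / s) ^ ?k * h q ^ ?k)"
      by (intro sum.cong refl, subst power_mult_distrib[symmetric]) (simp add: osc_def)
    also have "\<dots> \<le> (2 / s) ^ ?k * (4 * s) ^ ?k"
      unfolding sum_distrib_left[symmetric] using hs s_pos by (intro mult_left_mono) auto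
    also have "\<dots> = 8 ^ ?k" using s_pos by (subst power_mult_distrib[symmetric]) simp
    finally show "(\<Sum>q\<in>Q. osc q ^ ?k) \<le> 8 ^ ?k" .
    have "(\<Sum>q\<in>A. r q ^ ?k) * unit_ball_vol ?k \<le> measure lborel (punctured z t)"
    proof (rule torus_packing[where a = z and x = C])
      show "ball (C i) (r i) \<inter> ball (C j) (r j) = {}" if "i \<in> A" "j \<in> A" "i \<noteq> j" for i j
      proof -
        have "fibre i \<inter> fibre j = {}" using that(3) by auto
        then show ?thesis using Int_mono[OF C(1)[of i] C(1)[of j]] that AQ by auto
      qed
      show "dist (torus_proj z) (C i) + r i < 1/4" if i: "i \<in> A" for i
      proof -
        obtain x where x: "x \<in> fibre i \<inter> ball (torus_proj z) (1/16)"
          using Q(3)[OF subsetD[OF AQ(1) i]] by blast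
        then have "x \<in> cball (C i) (r i)" using C(2)[OF subsetD[OF AQ(1) i]] by blast
        moreover have "dist (torus_proj z) x < 1/16" using x by simp
        ultimately show ?thesis
          using dist_triangle[of "torus_proj z" "C i" x] rA[OF i] by (simp add: dist_commute)
      qed
      show "x \<in> punctured z t" if "i \<in> A" "x \<in> ball z (1/4)" "torus_proj x \<in> ball (C i) (r i)" for i x
      proof -
        have "\<phi> (torus_proj x) = i" using that C(1)[of i] AQ by blast
        then show ?thesis using A_near[OF that(1)] that(2) by (simp add: punctured_def dist_commute)
      qed
    qed (use AQ r punctured_fmeasurable in auto)
    then have *: "2 ^ ?k * ((\<Sum>q\<in>A. r q ^ ?k) * unit_ball_vol ?k) \<le> 2 ^ ?k * measure lborel (punctured z t)"
      by simp
    have "(\<Sum>q\<in>{q\<in>Q. osc q \<noteq> 0}. (2 * r q) ^ ?k) \<le> (\<Sum>q\<in>A. (2 * r q) ^ ?k)"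
      using AQ r by (intro sum_mono2) (auto simp: osc_def less_imp_le split: if_splits)
    also have "\<dots> = 2 ^ ?k * (\<Sum>q\<in>A. r q ^ ?k)" by (simp add: power_mult_distrib sum_distrib_left)
    finally have "(\<Sum>q\<in>{q\<in>Q. osc q \<noteq> 0}. (2 * r q) ^ ?k) * unit_ball_vol ?k
        \<le> 2 ^ ?k * (\<Sum>q\<in>A. r q ^ ?k) * unit_ball_vol ?k" using vol by (intro mult_right_mono) auto
    then show "(\<Sum>q\<in>{q\<in>Q. osc q \<noteq> 0}. (2 * r q) ^ ?k) * unit_ball_vol ?k
        \<le> 2 ^ ?k * measure lborel (punctured z t)" using * unfolding mult.assoc by (rule order_trans)
  qed
qed

end

section \<open>The part of the torus where the iterate is quasiconformal\<close>

context collapse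
begin

text \<open>The counterpart of \<open>fibre_part\<close> for balls around net points. Half-radius
  balls are disjoint in the source. Around the images, balls of radius \<open>l x * h / 2\<close>
  are disjoint and comparable to the image of the whole ball because the distortion is 2.\<close>

lemma net_part:
  assumes "\<eta> > 0" and W: "\<And>x. x \<in> W \<Longrightarrow> \<exists>l>0. lin_distort 2 l g (ball x \<eta>)"
    and near: "W \<subseteq> ball (torus_proj z) (1/16)"
  obtains X h osc where "finite X" "h > 0" "h \<le> 1/64" "W \<subseteq> (\<Union>x\<in>X. ball x h)"
    "\<And>x. x \<in> X \<Longrightarrow> osc x \<ge> 0"
    "\<And>x y y'. x \<in> X \<Longrightarrow> y \<in> ball x h \<Longrightarrow> y' \<in> ball x h \<Longrightarrow> \<bar>cutoff y - cutoff y'\<bar> \<le> osc x"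
    "(\<Sum>x\<in>X. osc x ^ CARD('n)) \<le> 32 ^ CARD('n)"
    "(\<Sum>x\<in>{x\<in>X. osc x \<noteq> 0}. (2 * h) ^ CARD('n)) * unit_ball_vol CARD('n)
       \<le> 4 ^ CARD('n) * measure lborel (punctured z t)"
proof -
  let ?k = "CARD('n)"
  have k: "?k > 0" by simp
  have vol: "unit_ball_vol ?k > 0" by simp
  obtain \<sigma>0 where \<sigma>0: "\<sigma>0 > 0" "\<And>x y. dist (g x) (g y) < \<sigma>0 \<Longrightarrow> dist x y < \<eta>"
    using funpow_uniformly_expansive[OF \<open>\<eta> > 0\<close>] by metis
  \<comment> \<open>With \<open>2 * \<sigma> \<le> s - \<rho>\<close>, a ball on which the cutoff
    varies has its image outside radius \<open>\<rho>\<close>, hence misses the fibre over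
    \<open>p0\<close>, and within \<open>3 * s\<close>, where \<open>near_phi\<close>
    applies.\<close>
  define \<sigma> where "\<sigma> = min (\<sigma>0 / 2) ((s - \<rho>) / 2)"
  have \<sigma>: "\<sigma> > 0" "2 * \<sigma> \<le> \<sigma>0" "2 * \<sigma> \<le> s - \<rho>" using \<sigma>0 rho by (auto simp: \<sigma>_def min_def)
  have "uniformly_continuous_on UNIV g"
    using compact_uniformly_continuous compact_torus continuous_funpow by blast
  then obtain h0 where h0: "h0 > 0" "\<And>x y. dist y x < h0 \<Longrightarrow> dist (g y) (g x) < \<sigma>"
    using \<sigma>(1) unfolding uniformly_continuous_on_def by (metis UNIV_I)
  define h where "h = Min {h0, \<eta>, 1/64}"
  have h: "h > 0" "h \<le> h0" "h \<le> \<eta>" "h \<le> 1/64" using h0(1) \<open>\<eta> > 0\<close> by (auto simp: h_def)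
  have g_near: "dist (g x) (g y) < \<sigma>" if "y \<in> ball x h" for x y
    using h0(2)[of x y] that h(2) by simp
  obtain X where X: "finite X" "X \<subseteq> W" "\<And>x y. x \<in> X \<Longrightarrow> y \<in> X \<Longrightarrow> x \<noteq> y \<Longrightarrow> dist x y \<ge> h"
    "W \<subseteq> (\<Union>x\<in>X. ball x h)"
    by (rule separated_net[OF compact_torus h(1) subset_UNIV[of W]]) blast
  have "\<forall>x\<in>X. \<exists>l>0. lin_distort 2 l g (ball x \<eta>)" using W X(2) by blast
  then obtain l where l: "\<And>x. x \<in> X \<Longrightarrow> l x > 0" "\<And>x. x \<in> X \<Longrightarrow> lin_distort 2 (l x) g (ball x \<eta>)"
    by metis
  have lower: "l x * dist y y' \<le> dist (g y) (g y')" and upper: "dist (g y) (g y') \<le> 2 * l x * dist y y'"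
    if "x \<in> X" "y \<in> ball x \<eta>" "y' \<in> ball x \<eta>" for x y y'
    using l(2)[OF that(1)] that(2,3) unfolding lin_distort_def by blast+
  have lh: "l x * h < 2 * \<sigma>" if x: "x \<in> X" for x
  proof -
    obtain a where a: "x = torus_proj a" using surj_torus_proj by blast
    define b where "b = a + (h/2) *\<^sub>R axis undefined (1 :: real)"
    have "dist a b = h/2" using h(1) norm_axis_1 by (simp add: b_def dist_norm)
    then have xb: "dist x (torus_proj b) = h/2" using dist_torus_proj_eq[of a b] h(4) a by simp
    have "x \<in> ball x \<eta>" "torus_proj b \<in> ball x \<eta>" using xb h \<open>\<eta> > 0\<close> by auto
    then have "l x * (h/2) \<le> dist (g x) (g (torus_proj b))" using lower[OF x] unfolding xb[symmetric] by blast
    also have "\<dots> < \<sigma>" using g_near[of "torus_proj b" x] xb h(1) by simp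
    finally show ?thesis by simp
  qed
  define A where "A = {x\<in>X. \<exists>y\<in>ball x h. \<exists>y'\<in>ball x h. cutoff y \<noteq> cutoff y'}"
  have AX: "A \<subseteq> X" "finite A" using X(1) by (auto simp: A_def)
  define osc where "osc = (\<lambda>x. if x \<in> A then 4 * l x * h / s else 0)"
  have witness: "\<exists>y\<in>ball x h. \<exists>y'\<in>ball x h. cutoff y < 1 \<and> cutoff y' > 0" if "x \<in> A" for x
    using that cutoff_neq_cases unfolding A_def by blast
  have A_dist: "dist (g v) y0 < 2 * s + 2 * \<sigma>" "dist (g v) y0 > s - 2 * \<sigma>" if x: "x \<in> A" "v \<in> ball x h" for x v
  proof -
    obtain y y' where y: "y \<in> ball x h" "cutoff y < 1" and y': "y' \<in> ball x h" "cutoff y' > 0"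
      using witness[OF x(1)] by blast
    have *: "dist (g v) (g w) < 2 * \<sigma>" if "w \<in> ball x h" for w
      using dist_triangle3[of "g v" "g w" "g x"] g_near[OF x(2)] g_near[OF that] by simp
    show "dist (g v) y0 < 2 * s + 2 * \<sigma>"
      using cutoff_less_1[OF y(2)] *[OF y(1)] dist_triangle[of "g v" y0 "g y"] by simp
    show "dist (g v) y0 > s - 2 * \<sigma>"
      using cutoff_pos[OF y'(2)] *[OF y'(1)] dist_triangle3[of "g y'" y0 "g v"] by (simp add: dist_commute)
  qed
  have A_phi: "\<phi> v \<in> ball p0 t - {p0}" if "x \<in> A" "v \<in> ball x h" for x v
    using near_phi[of v] far_phi[of v] A_dist[OF that] \<sigma>(3) rho by (auto simp: dist_commute)
  show ?thesis
  proof (rule that[of X h osc])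
    show "finite X" "h > 0" "h \<le> 1/64" "W \<subseteq> (\<Union>x\<in>X. ball x h)" using X h by auto
    fix x assume x: "x \<in> X"
    show "osc x \<ge> 0" using l(1)[OF x] h(1) s_pos by (simp add: osc_def)
    fix y y' assume y: "y \<in> ball x h" "y' \<in> ball x h"
    show "\<bar>cutoff y - cutoff y'\<bar> \<le> osc x"
    proof (cases "x \<in> A")
      case True
      have "dist y y' \<le> 2 * h" using y dist_triangle3[of y y' x] by simp
      then have "2 * l x * dist y y' \<le> 4 * l x * h"
        using mult_left_mono[of "dist y y'" "2 * h" "2 * l x"] l(1)[OF x] by simp
      moreover have "dist (g y) (g y') \<le> 2 * l x * dist y y'"
        using y h(3) by (intro upper[OF x]) auto
      ultimately have "dist (g y) (g y') \<le> 4 * l x * h" by linarith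
      then have "dist (g y) (g y') / s \<le> osc x" using True s_pos by (simp add: osc_def divide_right_mono)
      then show ?thesis using cutoff_lipschitz order_trans by blast
    next
      case False
      then have "cutoff y = cutoff y'" using x y unfolding A_def by blast
      then show ?thesis using False by (simp add: osc_def)
    qed
  next
    have "(\<Sum>x\<in>A. (l x * h / 2) ^ ?k) * unit_ball_vol ?k \<le> measure lborel (ball c (4 * s))"
    proof (rule torus_packing[where a = c and x = g])
      have near4: "dist y0 (g i) + l i * h / 2 < 4 * s" if "i \<in> A" for i
        using A_dist(1)[OF that, of i] lh[of i] AX that h(1) \<sigma>(3) rho by (auto simp: dist_commute)
      show "dist y0 (g i) + l i * h / 2 < 1/4" if "i \<in> A" for i
        using near4[OF that] s by linarith
      show "x \<in> ball c (4 * s)" if i: "i \<in> A" "x \<in> ball c (1/4)" "torus_proj x \<in> ball (g i) (l i * h / 2)" for i x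
      proof -
        have "dist y0 (torus_proj x) < 4 * s"
          using dist_triangle[of y0 "torus_proj x" "g i"] near4[OF i(1)] i(3) unfolding mem_ball by linarith
        then show ?thesis using dist_torus_proj_eq[of c x] i(2) by simp
      qed
      show "ball (g i) (l i * h / 2) \<inter> ball (g j) (l j * h / 2) = {}" if ij: "i \<in> A" "j \<in> A" "i \<noteq> j" for i j
      proof -
        have ijX: "i \<in> X" "j \<in> X" using ij AX by auto
        have hd: "h \<le> dist i j" using X(3)[OF ijX ij(3)] .
        \<comment> \<open>The lower distortion bound separates the images only of net points closer
          than \<open>\<eta>\<close>. For the others \<open>\<sigma>0\<close> does it, since both
          radii are below \<open>\<sigma>\<close>.\<close>
        have "l i * h / 2 + l j * h / 2 \<le> dist (g i) (g j)"
        proof (cases "dist i j < \<eta>")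
          case True
          have "l i * h \<le> l i * dist i j" "l j * h \<le> l j * dist i j"
            using hd l(1)[OF ijX(1)] l(1)[OF ijX(2)] by (auto intro!: mult_left_mono)
          moreover have "l i * dist i j \<le> dist (g i) (g j)" "l j * dist i j \<le> dist (g i) (g j)"
            using lower[OF ijX(1), of i j] lower[OF ijX(2), of i j] True \<open>\<eta> > 0\<close> by (auto simp: dist_commute)
          ultimately show ?thesis by linarith
        next
          case False
          then have "\<sigma>0 \<le> dist (g i) (g j)" using \<sigma>0(2)[of i j] by fastforce
          then show ?thesis using lh[OF ijX(1)] lh[OF ijX(2)] \<sigma>(2) by linarith
        qed
        then show ?thesis by (rule disjoint_ballI)
      qed
      show "l i * h / 2 > 0" if "i \<in> A" for i using l(1)[of i] that AX h(1) by auto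
    qed (use AX in \<open>auto intro!: fmeasurableI emeasure_lborel_ball_finite\<close>)
    also have "\<dots> = (4 * s) ^ ?k * unit_ball_vol ?k" using s_pos by (simp add: content_ball mult.commute)
    finally have hs: "(\<Sum>x\<in>A. (l x * h / 2) ^ ?k) \<le> (4 * s) ^ ?k" using vol by simp
    have "(\<Sum>x\<in>X. osc x ^ ?k) = (\<Sum>x\<in>A. osc x ^ ?k)"
      using X(1) AX k by (intro sum.mono_neutral_right) (auto simp: osc_def)
    also have "\<dots> = (\<Sum>x\<in>A. (8 / s) ^ ?k * (l x * h / 2) ^ ?k)"
      by (intro sum.cong refl, subst power_mult_distrib[symmetric]) (simp add: osc_def mult_ac)
    also have "\<dots> \<le> (8 / s) ^ ?k * (4 * s) ^ ?k"
      unfolding sum_distrib_left[symmetric] using hs s_pos by (intro mult_left_mono) auto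
    also have "\<dots> = 32 ^ ?k" using s_pos by (subst power_mult_distrib[symmetric]) simp
    finally show "(\<Sum>x\<in>X. osc x ^ ?k) \<le> 32 ^ ?k" .
    have "(\<Sum>x\<in>A. (h/2) ^ ?k) * unit_ball_vol ?k \<le> measure lborel (punctured z t)"
    proof (rule torus_packing[where a = z and x = "\<lambda>x. x"])
      show "ball i (h/2) \<inter> ball j (h/2) = {}" if "i \<in> A" "j \<in> A" "i \<noteq> j" for i j
        using X(3)[of i j] that AX by (intro disjoint_ballI) auto
      show "dist (torus_proj z) i + h/2 < 1/4" if "i \<in> A" for i
        using that AX X(2) near h(4) by fastforce
      show "x \<in> punctured z t" if "i \<in> A" "x \<in> ball z (1/4)" "torus_proj x \<in> ball i (h/2)" for i x
        using A_phi[OF that(1), of "torus_proj x"] that(2,3) h(1) by (simp add: punctured_def)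
    qed (use AX h punctured_fmeasurable in auto)
    then have *: "4 ^ ?k * ((\<Sum>x\<in>A. (h/2) ^ ?k) * unit_ball_vol ?k) \<le> 4 ^ ?k * measure lborel (punctured z t)"
      by simp
    have "(\<Sum>x\<in>{x\<in>X. osc x \<noteq> 0}. (2 * h) ^ ?k) \<le> (\<Sum>x\<in>A. (2 * h) ^ ?k)"
      using AX h by (intro sum_mono2) (auto simp: osc_def split: if_splits)
    also have "\<dots> = 4 ^ ?k * (\<Sum>x\<in>A. (h/2) ^ ?k)"
      unfolding sum_distrib_left by (intro sum.cong refl, subst power_mult_distrib[symmetric]) simp
    finally have "(\<Sum>x\<in>{x\<in>X. osc x \<noteq> 0}. (2 * h) ^ ?k) * unit_ball_vol ?k
        \<le> 4 ^ ?k * (\<Sum>x\<in>A. (h/2) ^ ?k) * unit_ball_vol ?k" using vol by (intro mult_right_mono) auto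
    then show "(\<Sum>x\<in>{x\<in>X. osc x \<noteq> 0}. (2 * h) ^ ?k) * unit_ball_vol ?k
        \<le> 4 ^ ?k * measure lborel (punctured z t)" using * unfolding mult.assoc by (rule order_trans)
  qed
qed

end

text \<open>The fat fibres and the net balls together cover all segments. The bound involves neither
  \<open>n\<close>, \<open>s\<close> nor the scale of quasiconformality; only \<open>M\<close> and
  the punctured volume can still be adjusted.\<close>

lemma (in collapse) width_bound:
  fixes u :: "real ^ 'n"
  assumes dim: "CARD('n) \<ge> 2" and u: "norm u = 1" and k: "0 < k" "k \<le> 1/32" and M: "M \<ge> 1"
    and inner: "\<And>w. w \<in> ball 0 (k/2) \<Longrightarrow> \<phi> (torus_proj (z + w + (- k) *\<^sub>R u)) = p0"
    and outer: "\<And>w. w \<in> ball 0 (k/2) \<Longrightarrow> dist (\<phi> (torus_proj (z + w + k *\<^sub>R u))) p0 \<ge> t"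
  shows "(k/2) ^ CARD('n) \<le> 10 * 2 ^ CARD('n) *
    (M * (2 ^ CARD('n) + 4 ^ CARD('n)) * measure lborel (punctured z t) / unit_ball_vol CARD('n)
     + (8 ^ CARD('n) + 32 ^ CARD('n)) / M)"
proof -
  let ?k = "CARD('n)"
  let ?B = "ball (torus_proj z) (1/16) :: 'n torus set"
  define m where "m = measure lborel (punctured z t) / unit_ball_vol ?k"
  have vol: "unit_ball_vol ?k > 0" by simp
  obtain \<eta> where \<eta>: "\<eta> > 0" "\<And>x. (\<exists>q. ball x \<eta> \<subseteq> fibre q) \<or> (\<exists>l>0. lin_distort 2 l g (ball x \<eta>))"
    using quasiconformal_funpow[of 2 n] unfolding quasiconformal_def by auto
  define F where "F = {q. \<exists>x. ball x \<eta> \<subseteq> fibre q}"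
  define Q where "Q = {q\<in>F. fibre q \<inter> ?B \<noteq> {}}"
  define W where "W = ?B - (\<Union>q\<in>F. fibre q)"
  have fin: "finite Q" using finite_fat_fibres[OF \<eta>(1)] by (simp add: Q_def F_def)
  have ball_Q: "euclidean_ball (fibre q)" if "q \<in> Q" for q
    using that ball_fibre_fat \<eta>(1) unfolding Q_def F_def by blast
  obtain osc1 d1 where
    A: "\<And>q. q \<in> Q \<Longrightarrow> osc1 q \<ge> 0" "\<And>q. q \<in> Q \<Longrightarrow> 0 < d1 q" "\<And>q. q \<in> Q \<Longrightarrow> d1 q \<le> 1"
    "\<And>q x y. q \<in> Q \<Longrightarrow> x \<in> fibre q \<Longrightarrow> y \<in> fibre q \<Longrightarrow> dist x y \<le> d1 q"
    "\<And>q x y. q \<in> Q \<Longrightarrow> x \<in> fibre q \<Longrightarrow> y \<in> fibre q \<Longrightarrow> \<bar>cutoff x - cutoff y\<bar> \<le> osc1 q"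
    "(\<Sum>q\<in>Q. osc1 q ^ ?k) \<le> 8 ^ ?k"
    "(\<Sum>q\<in>{q\<in>Q. osc1 q \<noteq> 0}. d1 q ^ ?k) * unit_ball_vol ?k \<le> 2 ^ ?k * measure lborel (punctured z t)"
    by (rule fibre_part[OF fin ball_Q]) (auto simp: Q_def)
  have W_near: "W \<subseteq> ?B" by (auto simp: W_def)
  have W: "\<exists>l>0. lin_distort 2 l g (ball x \<eta>)" if "x \<in> W" for x
  proof (rule ccontr)
    assume "\<not> ?thesis"
    then obtain q where q: "ball x \<eta> \<subseteq> fibre q" using \<eta>(2)[of x] by blast
    then have "q \<in> F" by (auto simp: F_def)
    moreover have "x \<in> fibre q" using q \<eta>(1) centre_in_ball by blast
    ultimately show False using that by (auto simp: W_def)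
  qed
  obtain X h osc2 where
    X: "finite X" "h > 0" "h \<le> 1/64" "W \<subseteq> (\<Union>x\<in>X. ball x h)"
    and B: "\<And>x. x \<in> X \<Longrightarrow> osc2 x \<ge> 0"
    "\<And>x y y'. x \<in> X \<Longrightarrow> y \<in> ball x h \<Longrightarrow> y' \<in> ball x h \<Longrightarrow> \<bar>cutoff y - cutoff y'\<bar> \<le> osc2 x"
    "(\<Sum>x\<in>X. osc2 x ^ ?k) \<le> 32 ^ ?k"
    "(\<Sum>x\<in>{x\<in>X. osc2 x \<noteq> 0}. (2 * h) ^ ?k) * unit_ball_vol ?k \<le> 4 ^ ?k * measure lborel (punctured z t)"
    by (rule net_part[OF \<eta>(1) W W_near], assumption) (rule that)
  define E where "E = case_sum fibre (\<lambda>x. ball x h)"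
  define osc where "osc = case_sum osc1 osc2"
  define d where "d = case_sum d1 (\<lambda>x :: 'n torus. 2 * h)"
  define J where "J = Q <+> X"
  have "(k/2) ^ ?k \<le> 10 * 2 ^ ?k * (\<Sum>j\<in>J. osc j * d j ^ (?k - 1))"
  proof (rule crossing_estimate[OF u k, where z = z and E = E and \<psi> = cutoff])
    show "finite J" using fin X(1) by (simp add: J_def)
    show "continuous_on UNIV cutoff" by (rule continuous_cutoff)
    show "cutoff (torus_proj (z + w + (- k) *\<^sub>R u)) = 0" if "w \<in> ball 0 (k/2)" for w
      using inner[OF that] by (rule cutoff_eq_0)
    show "cutoff (torus_proj (z + w + k *\<^sub>R u)) = 1" if "w \<in> ball 0 (k/2)" for w
      using outer[OF that] by (rule cutoff_eq_1)
    fix j assume j: "j \<in> J"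
    show "0 < d j" "d j \<le> 1" "osc j \<ge> 0"
      using j A(1-3) B(1) X(2,3) by (auto simp: J_def d_def osc_def)
    fix x y assume xy: "x \<in> E j" "y \<in> E j"
    show "\<bar>cutoff x - cutoff y\<bar> \<le> osc j"
      using j xy A(5) B(2) unfolding J_def E_def osc_def by (elim PlusE) simp_all
    show "dist x y \<le> d j"
    proof (cases j)
      case (Inl q)
      then show ?thesis using j xy A(4) by (auto simp: J_def E_def d_def)
    next
      case (Inr a)
      then show ?thesis using xy dist_triangle3[of x y a] by (simp add: E_def d_def)
    qed
  next
    fix w :: "real ^ 'n" and \<tau> assume w: "w \<in> ball 0 (k/2)" "\<tau> \<in> {-k..k}"
    define x where "x = torus_proj (z + w + \<tau> *\<^sub>R u)"
    have "dist z (z + w + \<tau> *\<^sub>R u) \<le> norm w + \<bar>\<tau>\<bar>"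
      using norm_triangle_ineq[of w "\<tau> *\<^sub>R u"] u norm_minus_cancel[of "w + \<tau> *\<^sub>R u"]
      by (simp add: dist_norm algebra_simps)
    also have "\<dots> < 1/16" using w k by auto
    finally have x: "x \<in> ?B"
      using dist_torus_proj_le[of z "z + w + \<tau> *\<^sub>R u"] by (simp add: x_def)
    show "\<exists>j\<in>J. x \<in> E j"
    proof (cases "x \<in> W")
      case True
      then obtain a where "a \<in> X" "x \<in> ball a h" using X(4) by blast
      then show ?thesis by (intro bexI[of _ "Inr a"]) (auto simp: J_def E_def)
    next
      case False
      then obtain q where "q \<in> F" "x \<in> fibre q" using x by (auto simp: W_def)
      moreover from this have "q \<in> Q" using x by (auto simp: Q_def)
      ultimately show ?thesis by (intro bexI[of _ "Inl q"]) (auto simp: J_def E_def)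
    qed
  qed
  also have "(\<Sum>j\<in>J. osc j * d j ^ (?k - 1))
      = (\<Sum>q\<in>Q. osc1 q * d1 q ^ (?k - 1)) + (\<Sum>x\<in>X. osc2 x * (2 * h) ^ (?k - 1))"
    unfolding J_def using fin X(1) by (simp add: sum.Plus osc_def d_def)
  finally have main: "(k/2) ^ ?k \<le> 10 * 2 ^ ?k *
     ((\<Sum>q\<in>Q. osc1 q * d1 q ^ (?k - 1)) + (\<Sum>x\<in>X. osc2 x * (2 * h) ^ (?k - 1)))" .
  \<comment> \<open>Indices with zero oscillation are dropped before Young's inequality, since only
    the diameters of the remaining ones are controlled by the punctured volume.\<close>
  have young: "(\<Sum>i\<in>I. o' i * e i ^ (?k - 1)) \<le> M * (\<Sum>i\<in>{i\<in>I. o' i \<noteq> 0}. e i ^ ?k) + (\<Sum>i\<in>I. o' i ^ ?k) / M"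
    if "finite I" "\<And>i. i \<in> I \<Longrightarrow> o' i \<ge> 0" "\<And>i. i \<in> I \<Longrightarrow> e i \<ge> 0" for I :: "'n torus set" and o' e :: "'n torus \<Rightarrow> real"
  proof -
    have "(\<Sum>i\<in>I. o' i * e i ^ (?k - 1)) = (\<Sum>i\<in>{i\<in>I. o' i \<noteq> 0}. o' i * e i ^ (?k - 1))"
      using that(1) by (intro sum.mono_neutral_right) auto
    also have "\<dots> \<le> (\<Sum>i\<in>{i\<in>I. o' i \<noteq> 0}. M * e i ^ ?k + o' i ^ ?k / M)"
      using that dim M by (intro sum_mono mult_power_le_weighted_sum) auto
    also have "\<dots> = M * (\<Sum>i\<in>{i\<in>I. o' i \<noteq> 0}. e i ^ ?k) + (\<Sum>i\<in>{i\<in>I. o' i \<noteq> 0}. o' i ^ ?k) / M"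
      by (simp add: sum.distrib sum_distrib_left sum_divide_distrib)
    also have "(\<Sum>i\<in>{i\<in>I. o' i \<noteq> 0}. o' i ^ ?k) \<le> (\<Sum>i\<in>I. o' i ^ ?k)"
      using that by (intro sum_mono2) auto
    finally show ?thesis using M by (simp add: divide_right_mono)
  qed
  have "(\<Sum>q\<in>Q. osc1 q * d1 q ^ (?k - 1)) \<le> M * (2 ^ ?k * m) + 8 ^ ?k / M"
  proof -
    have "(\<Sum>q\<in>{q\<in>Q. osc1 q \<noteq> 0}. d1 q ^ ?k) \<le> 2 ^ ?k * m"
      using A(7) vol by (simp add: m_def pos_le_divide_eq)
    then have "M * (\<Sum>q\<in>{q\<in>Q. osc1 q \<noteq> 0}. d1 q ^ ?k) \<le> M * (2 ^ ?k * m)" using M by simp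
    moreover have "(\<Sum>q\<in>Q. osc1 q ^ ?k) / M \<le> 8 ^ ?k / M" using A(6) M by (intro divide_right_mono) auto
    moreover have "(\<Sum>q\<in>Q. osc1 q * d1 q ^ (?k - 1))
        \<le> M * (\<Sum>q\<in>{q\<in>Q. osc1 q \<noteq> 0}. d1 q ^ ?k) + (\<Sum>q\<in>Q. osc1 q ^ ?k) / M"
      by (intro young fin A(1) less_imp_le[OF A(2)])
    ultimately show ?thesis by linarith
  qed
  moreover have "(\<Sum>x\<in>X. osc2 x * (2 * h) ^ (?k - 1)) \<le> M * (4 ^ ?k * m) + 32 ^ ?k / M"
  proof -
    have "(\<Sum>x\<in>{x\<in>X. osc2 x \<noteq> 0}. (2 * h) ^ ?k) \<le> 4 ^ ?k * m"
      using B(4) vol unfolding m_def times_divide_eq_right by (subst pos_le_divide_eq)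
    then have "M * (\<Sum>x\<in>{x\<in>X. osc2 x \<noteq> 0}. (2 * h) ^ ?k) \<le> M * (4 ^ ?k * m)"
      using M by (intro mult_left_mono) auto
    moreover have "(\<Sum>x\<in>X. osc2 x ^ ?k) / M \<le> 32 ^ ?k / M" using B(3) M by (intro divide_right_mono) auto
    moreover have "(\<Sum>x\<in>X. osc2 x * (2 * h) ^ (?k - 1))
        \<le> M * (\<Sum>x\<in>{x\<in>X. osc2 x \<noteq> 0}. (2 * h) ^ ?k) + (\<Sum>x\<in>X. osc2 x ^ ?k) / M"
      using X(2) by (intro young X(1) B(1)) auto
    ultimately show ?thesis by linarith
  qed
  ultimately have sum: "(\<Sum>q\<in>Q. osc1 q * d1 q ^ (?k - 1)) + (\<Sum>x\<in>X. osc2 x * (2 * h) ^ (?k - 1))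
      \<le> M * (2 ^ ?k * m) + 8 ^ ?k / M + (M * (4 ^ ?k * m) + 32 ^ ?k / M)" by linarith
  also have "\<dots> = M * (2 ^ ?k + 4 ^ ?k) * m + (8 ^ ?k + 32 ^ ?k) / M"
    by (simp add: distrib_left distrib_right add_divide_distrib)
  also have "M * (2 ^ ?k + 4 ^ ?k) * m = M * (2 ^ ?k + 4 ^ ?k) * measure lborel (punctured z t) / unit_ball_vol ?k"
    by (simp add: m_def)
  finally show ?thesis using main by (meson mult_left_mono order_trans zero_le_mult_iff zero_le_numeral zero_le_power)
qed

text \<open>The segments cross the boundary sphere of the fibre near \<open>z\<close>, at a width
  \<open>k\<close> that depends on this fibre alone. Both terms of \<open>width_bound\<close> are
  made smaller than a third of the fixed left side.\<close>

lemma (in round_fibres) no_round_fibres: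
  assumes dim: "CARD('n) \<ge> 2"
  shows False
proof -
  let ?k = "CARD('n)"
  have vol: "unit_ball_vol ?k > 0" by simp
  obtain c0 r0 where c0: "0 < r0" "r0 < 1/2" "fibre p0 = torus_proj ` cball c0 r0"
    using ball_p0 by (rule euclidean_ballE)
  define u :: "real ^ 'n" where "u = axis undefined 1"
  have u: "norm u = 1" unfolding u_def by (rule norm_axis_1)
  \<comment> \<open>\<open>r0/2\<close> keeps the inner ends in the fibre. The last bound gives
    \<open>2 * r0 + 3 * k / 2 < 1\<close>, so the outer ends do not meet another lift of it.\<close>
  define k where "k = Min {1/32, r0/2, (1 - 2 * r0) / 4}"
  have "0 < k" using c0 by (simp add: k_def)
  moreover have "k \<le> 1/32" "k \<le> r0/2" "k \<le> (1 - 2 * r0) / 4"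
    unfolding k_def by (intro Min_le; simp)+
  ultimately have k: "0 < k" "k \<le> 1/32" "k \<le> r0/2" "k \<le> (1 - 2 * r0) / 4" .
  define z where "z = c0 + r0 *\<^sub>R u"
  have inner: "\<phi> (torus_proj (z + w + (- k) *\<^sub>R u)) = p0" if w: "w \<in> ball 0 (k/2)" for w
  proof -
    have eq: "z + w + (- k) *\<^sub>R u - c0 = (r0 - k) *\<^sub>R u + w" by (simp add: z_def algebra_simps)
    have "norm ((r0 - k) *\<^sub>R u + w) \<le> (r0 - k) + k/2"
      using norm_triangle_ineq[of "(r0 - k) *\<^sub>R u" w] u w k c0(1) by simp
    then have "norm (z + w + (- k) *\<^sub>R u - c0) \<le> r0" unfolding eq using k(1) by linarith
    then have "z + w + (- k) *\<^sub>R u \<in> cball c0 r0"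
      unfolding mem_cball dist_norm by (subst norm_minus_commute)
    then show ?thesis using c0(3) by blast
  qed
  \<comment> \<open>Stated on the closed ball, so that compactness turns inequality into the
    positive distance \<open>t1\<close>.\<close>
  have outer: "\<phi> (torus_proj (z + w + k *\<^sub>R u)) \<noteq> p0" if w: "w \<in> cball 0 (k/2)" for w
  proof
    assume "\<phi> (torus_proj (z + w + k *\<^sub>R u)) = p0"
    then obtain v where v: "v \<in> cball c0 r0" "torus_proj (z + w + k *\<^sub>R u) = torus_proj v"
      using c0(3) by (metis imageE vimage_singleton_eq)
    define b where "b = z + w + k *\<^sub>R u"
    have b: "b - c0 = (r0 + k) *\<^sub>R u + w" by (simp add: b_def z_def algebra_simps)
    have w': "norm w \<le> k/2" using w by simp
    have nu: "norm ((r0 + k) *\<^sub>R u) = r0 + k" using u c0(1) k(1) by simp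
    have up: "norm (b - c0) \<le> r0 + 3 * k / 2"
      unfolding b using norm_triangle_ineq[of "(r0 + k) *\<^sub>R u" w] w' nu by simp
    have lo: "norm (b - c0) \<ge> r0 + k / 2"
      unfolding b using norm_diff_ineq[of "(r0 + k) *\<^sub>R u" w] w' nu by simp
    have "b \<noteq> v" using lo v(1) k(1) by (auto simp: dist_norm norm_minus_commute)
    moreover have "b - v \<in> int_lattice" using v(2) by (simp add: b_def torus_proj_eq_iff)
    ultimately have "norm (b - v) \<ge> 1" using norm_int_lattice_ge_1 by (metis right_minus_eq)
    moreover have "norm (b - v) \<le> norm (b - c0) + norm (c0 - v)"
      using norm_triangle_ineq[of "b - c0" "c0 - v"] by simp
    moreover have "norm (c0 - v) \<le> r0" using v(1) by (simp add: dist_norm)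
    ultimately have "1 \<le> 2 * r0 + 3 * k / 2" using up by simp
    then show False using k(1,4) by simp
  qed
  have cont: "continuous_on UNIV (\<lambda>w. \<phi> (torus_proj (z + w + k *\<^sub>R u)))"
    by (intro continuous_on_compose2[OF continuous_phi_proj] continuous_intros) auto
  have "compact ((\<lambda>w. \<phi> (torus_proj (z + w + k *\<^sub>R u))) ` cball 0 (k/2))"
    by (rule compact_continuous_image[OF continuous_on_subset[OF cont subset_UNIV] compact_cball])
  moreover have "p0 \<notin> (\<lambda>w. \<phi> (torus_proj (z + w + k *\<^sub>R u))) ` cball 0 (k/2)" using outer by force
  ultimately obtain t1 where t1: "t1 > 0"
      "\<And>w. w \<in> cball 0 (k/2) \<Longrightarrow> t1 \<le> dist p0 (\<phi> (torus_proj (z + w + k *\<^sub>R u)))"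
    using dist_closed_point_pos[OF compact_imp_closed] by (metis (no_types, lifting) imageI)
  \<comment> \<open>Keeping \<open>t\<close> below the distance from \<open>p0\<close> to these
    finitely many points makes all other fibres near that of \<open>p0\<close> small, as
    \<open>thin\<close> demands.\<close>
  define q where "q = {q. \<exists>x. ball x (1/32) \<subseteq> fibre q} - {p0}"
  have "finite q" using finite_fat_fibres[of "1/32"] by (simp add: q_def)
  then obtain t2 where t2: "t2 > 0" "\<And>y. y \<in> q \<Longrightarrow> t2 \<le> dist p0 y"
    using dist_closed_point_pos[OF finite_imp_closed, of q p0] unfolding q_def by blast
  define C where "C = 10 * 2 ^ ?k * (8 ^ ?k + 32 ^ ?k :: real)"
  define \<delta> where "\<delta> = (k/2) ^ ?k"
  have C: "C > 0" and \<delta>: "\<delta> > 0" using k(1) by (auto simp: C_def \<delta>_def add_pos_pos)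
  define M where "M = max 1 (3 * C / \<delta>)"
  have M: "M \<ge> 1" "C / M \<le> \<delta> / 3"
    using C \<delta> by (auto simp: M_def field_simps max_def)
  define D where "D = 10 * 2 ^ ?k * (M * (2 ^ ?k + 4 ^ ?k)) / unit_ball_vol ?k"
  have D: "D > 0" unfolding D_def using M(1) vol by (intro divide_pos_pos mult_pos_pos add_pos_pos) auto
  obtain t3 where t3: "t3 > 0" "\<And>t'. t' \<le> t3 \<Longrightarrow> measure lborel (punctured z t') < \<delta> / (3 * D)"
    using punctured_small[of "\<delta> / (3 * D)" z] \<delta> D by auto
  define t where "t = Min {t1, t2, t3}"
  have t: "t > 0" "t \<le> t1" "t \<le> t2" "t \<le> t3" using t1 t2 t3 by (auto simp: t_def)
  have "uniformly_continuous_on UNIV \<phi>" using compact_uniformly_continuous compact_torus cont_phi by blast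
  then obtain s0 where s0: "s0 > 0" "\<And>x y. dist y x < s0 \<Longrightarrow> dist (\<phi> y) (\<phi> x) < t"
    using t(1) unfolding uniformly_continuous_on_def by (metis UNIV_I)
  \<comment> \<open>\<open>s0/3\<close> is for the radius \<open>3 * s\<close> in
    \<open>phi_close\<close>; with 1/32, the ball of radius \<open>4 * s\<close> used for packing
    fits into a chart.\<close>
  define s where "s = min (s0/3) (1/32)"
  have s: "s > 0" "3 * s \<le> s0" "s \<le> 1/32" using s0(1) by (auto simp: s_def)
  obtain n c \<rho> where \<rho>: "0 < \<rho>" "\<rho> < s" "fibre ((T ^^ n) p0) = torus_proj ` cball c \<rho>"
    using thin_fibre_forward[OF s(1)] by metis
  interpret collapse f \<phi> \<theta> p0 z c n \<rho> s t
  proof unfold_locales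
    show "dist (\<phi> x) (\<phi> y) < t" if "dist x y < 3 * s" for x y using s0(2) that s(2) by simp
    show "\<not> ball x (1/32) \<subseteq> fibre y" if "y \<noteq> p0" "dist y p0 < t" for x y
      using t2(2)[of y] that t(3) by (auto simp: q_def dist_commute)
  qed (use \<rho> s in auto)
  have "\<delta> \<le> 10 * 2 ^ ?k * (M * (2 ^ ?k + 4 ^ ?k) * measure lborel (punctured z t) / unit_ball_vol ?k
     + (8 ^ ?k + 32 ^ ?k) / M)"
    unfolding \<delta>_def
  proof (rule width_bound[OF dim u k(1,2) M(1) inner])
    show "t \<le> dist (\<phi> (torus_proj (z + w + k *\<^sub>R u))) p0" if "w \<in> ball 0 (k/2)" for w
      using t1(2)[of w] that t(2) by (simp add: dist_commute)
  qed
  also have "\<dots> = D * measure lborel (punctured z t) + C / M"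
    by (simp add: D_def C_def distrib_left)
  also have "\<dots> < D * (\<delta> / (3 * D)) + \<delta> / 3"
    using t3(2)[OF t(4)] D M(2) by (intro add_less_le_mono mult_strict_left_mono) auto
  also have "\<dots> = 2 * \<delta> / 3" using D by simp
  finally show False using \<delta> by simp
qed

theorem mainTheorem1:
  fixes f R \<phi> :: "'n::finite torus \<Rightarrow> 'n torus"
  assumes "CARD('n) \<ge> 2"
    and "torus_diffeomorphism f"
    and "translation R"
    and "minimal R"
    and "semiconjugacy \<phi> f R"
    and "\<not> topologically_conjugate f R"
    and "\<And>p. (\<exists>x. \<phi> -` {p} = {x}) \<or> euclidean_ball (\<phi> -` {p})"
  shows "\<not> torus_Ck (CARD('n) + 1) f"
proof -
  obtain \<theta> where R: "R = (\<lambda>x. x + \<theta>)" using assms(3) by (auto simp: translation_def)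
  have phi: "continuous_on UNIV \<phi>" "surj \<phi>" "\<phi> \<circ> f = R \<circ> \<phi>"
    using assms(5) by (auto simp: semiconjugacy_def)
  \<comment> \<open>If all fibres were points, \<open>\<phi>\<close> would be a continuous bijection
    of a compact Hausdorff space, hence a conjugacy.\<close>
  have "\<exists>p. euclidean_ball (\<phi> -` {p})"
  proof (rule ccontr)
    assume "\<not> ?thesis"
    then have single: "\<And>p. \<exists>x. \<phi> -` {p} = {x}" using assms(7) by blast
    have "inj \<phi>"
    proof (rule injI)
      fix x y assume "\<phi> x = \<phi> y"
      then have "x \<in> \<phi> -` {\<phi> y}" "y \<in> \<phi> -` {\<phi> y}" by auto
      then show "x = y" using single[of "\<phi> y"] by (metis singletonD)
    qed
    then obtain h where "homeomorphism UNIV UNIV \<phi> h"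
      using homeomorphism_compact[OF compact_torus phi(1,2)] by blast
    then show False using assms(6) phi(3) unfolding topologically_conjugate_def by blast
  qed
  then obtain p0 where p0: "euclidean_ball (\<phi> -` {p0})" by blast
  interpret round_fibres f \<phi> \<theta> p0
  proof
    show "\<phi> (f x) = \<phi> x + \<theta>" for x using phi(3) R by (metis comp_apply)
    show "closure (full_orbit (\<lambda>x. x + \<theta>) p0) = UNIV" using assms(4) R by (simp add: minimal_def)
  qed (use assms(2,7) phi p0 in \<open>auto simp: torus_diffeomorphism_def\<close>)
  show ?thesis using no_round_fibres assms(1) by blast
qed

end
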